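(* Let $p>3$ be a prime. Then: (a) $$\sum_{k=0}^{p-1}\frac{\binom{4k}{2k}\binom{2k}k}{64^k}H_k^{(2)}\equiv-E_{p^2-p-2}\left(\frac14\right)\pmod{p^2},\qquad \sum_{k=0}^{p-1}\frac{\binom{4k}{2k}\binom{2k}k}{64^k}H_k^{(2)}\equiv-E_{p-3}\left(\frac14\right)\pmod p.$$ (b) $$\sum_{k=0}^{p-1}\frac{\binom{2k}k^2}{16^k}H_k^{(2)}\equiv\frac14\sum_{k=0}^{p-1}\frac{\binom{4k}{2k}\binom{2k}k}{(2k+1)64^k}H_k^{(2)}\equiv\frac15\sum_{k=0}^{p-1}\frac{\binom{6k}{3k}\binom{3k}k}{432^k}H_k^{(2)}\equiv-4E_{p^2-p-2}\pmod{p^2},$$ and $$\sum_{k=0}^{p-1}\frac{\binom{2k}k^2}{16^k}H_k^{(2)}\equiv-4E_{p-3}\pmod p.$$ (c) $$\sum_{k=0}^{p-1}\frac{\binom{2k}k\binom{3k}k}{27^k}H_k^{(2)}\equiv\frac12\sum_{k=0}^{p-1}\frac{\binom{2k}k\binom{3k}k}{(2k+1)27^k}H_k^{(2)}\equiv\frac15\sum_{k=0}^{p-1}\frac{\binom{6k}{3k}\binom{3k}k}{(2k+1)432^k}H_k^{(2)}\equiv(3p-3)B_{p^2-p-1}\left(\frac13\right)\pmod{p^2},$$ and $$\sum_{k=0}^{p-1}\frac{\binom{2k}k\binom{3k}k}{27^k}H_k^{(2)}\equiv-\frac32B_{p-2}\left(\frac13\right)\pmod p.$$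
   Context: For $n\in\mathbb N=\{0,1,2,\ldots\}$, $H_n^{(2)}=\sum_{0<k\le n}\frac1{k^2}$ is the second-order harmonic number. $B_0,B_1,\ldots$ are the Bernoulli numbers (with $B_1=-\frac12$) and $B_n(x)=\sum_{k=0}^n\binom nkB_kx^{n-k}$ is the Bernoulli polynomial of degree $n$. $E_0,E_1,\ldots$ are the Euler numbers and $E_n(x)=\sum_{k=0}^n\binom nk\frac{E_k}{2^k}\left(x-\frac12\right)^{n-k}$ is the Euler polynomial of degree $n$; $E_n$ without argument is the Euler number. Congruences modulo $p^j$ are in the ring $\mathbb Z_p$ of $p$-adic integers (equivalently, among rationals with denominator prime to $p$). *)

theory Defs
  imports Complex_Main "HOL-Computational_Algebra.Primes"
begin

definition harmonic2 :: "nat \<Rightarrow> rat" where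
  "harmonic2 n = (\<Sum>k\<in>{0<..n}. 1 / of_nat k ^ 2)"

(* For n > 0 this is the recurrence (\<Sum>k\<le>n. (n + 1 choose k) * B k) = 0 solved for B n;
   it gives B 1 = -1/2. *)
fun bernoulli_num :: "nat \<Rightarrow> rat" where
  "bernoulli_num n = (if n = 0 then 1 else
     - (\<Sum>k\<in>{..<n}. of_nat (Suc n choose k) * bernoulli_num k) / of_nat (Suc n))"

definition bernoulli_poly :: "nat \<Rightarrow> rat \<Rightarrow> rat" where
  "bernoulli_poly n x = (\<Sum>k\<le>n. of_nat (n choose k) * bernoulli_num k * x ^ (n - k))"

(* The integer sequence 1, 0, -1, 0, 5, 0, -61, ... with exponential generating function 1 / cosh.
   For n > 0 this is the recurrence (\<Sum>k\<le>n with n - k even. (n choose k) * E k) = 0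
   solved for E n. *)
fun euler_num :: "nat \<Rightarrow> rat" where
  "euler_num n = (if n = 0 then 1 else
     - (\<Sum>k\<in>{..<n}. if even (n - k) then of_nat (n choose k) * euler_num k else 0))"

definition euler_poly :: "nat \<Rightarrow> rat \<Rightarrow> rat" where
  "euler_poly n x = (\<Sum>k\<le>n. of_nat (n choose k) * (euler_num k / 2 ^ k) * (x - 1 / 2) ^ (n - k))"

(* The two recursion equations above loop as rewrite rules. *)
declare bernoulli_num.simps [simp del] euler_num.simps [simp del]

(* The rational p-adic integers. *)
definition padic_integral :: "nat \<Rightarrow> rat set" where
  "padic_integral p = {of_int a / of_int b | a b. \<not> int p dvd b}"

(* Congruence of rationals modulo p ^ j in the ring of p-adic integers;
   it entails that both sides are p-adic integers. *)
definition padic_cong :: "nat \<Rightarrow> nat \<Rightarrow> rat \<Rightarrow> rat \<Rightarrow> bool" where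
  "padic_cong p j x y \<longleftrightarrow> x \<in> padic_integral p \<and> y \<in> padic_integral p \<and>
     (\<exists>z\<in>padic_integral p. x - y = of_nat p ^ j * z)"

end

theory Submission
  imports Defs "HOL-Number_Theory.Residues"
begin

text \<open>The binomial products are \<open>c\<^sub>k(x) = (x gchoose k) * ((-1 - x) gchoose k)\<close> at
  \<open>x = -1/2, -1/3, -1/4, -1/6\<close>. Let \<open>S(x)\<close> be the sum of \<open>c\<^sub>k(x) H\<^sub>k\<close> over \<open>k < p\<close>, and \<open>U(x)\<close> be
  \<open>2x + 1\<close> times the sum of \<open>c\<^sub>k(x) H\<^sub>k / (2k + 1)\<close>. Summation by parts gives
  \<open>S(x) + S(x - 1) = U(x) - U(x - 1)\<close>, and modulo \<open>p\<^sup>j\<close> this is \<open>-2 x\<^sup>m\<close> where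
  \<open>m + 2 = \<phi>(p\<^sup>j)\<close>. By p-adic continuity, the first difference equation determines \<open>S\<close>
  modulo \<open>p\<^sup>j\<close>, and the second one, together with \<open>U(-1 - x) = -U(x)\<close>, determines \<open>U\<close>.
  Hence \<open>S(x)\<close> is congruent to \<open>-E\<^sub>m(x + 1)\<close> and \<open>U(x)\<close> to \<open>-2/(m + 1) B\<^sub>m\<^sub>+\<^sub>1(x + 1)\<close>, and \<open>S\<close>
  and \<open>U\<close> inherit the multiplication formulas of the Euler and Bernoulli polynomials, which
  relate the special values.\<close>


section \<open>Divisibility in the ring of rational p-adic integers\<close>

text \<open>A congruence modulo \<open>p ^ i\<close> becomes membership of the difference in the
  ideal generated by \<open>p ^ i\<close>, so that closure under sums and multiples can be applied
  directly.\<close>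

definition padic_ideal :: "nat \<Rightarrow> nat \<Rightarrow> rat set" where
  "padic_ideal p i = {of_nat p ^ i * z | z. z \<in> padic_integral p}"

lemma padic_cong_iff:
  "padic_cong p j x y \<longleftrightarrow>
     x \<in> padic_integral p \<and> y \<in> padic_integral p \<and> x - y \<in> padic_ideal p j"
  by (auto simp: padic_cong_def padic_ideal_def)

locale padic =
  fixes p :: nat
  assumes prime: "prime p"
begin

abbreviation Z where "Z \<equiv> padic_integral p"
abbreviation Id where "Id \<equiv> padic_ideal p"

lemma p_nonzero [simp]: "p \<noteq> 0"
  using prime by auto

lemma prime_int: "prime (int p)"
  using prime by simp

lemma Z_frac: "\<not> int p dvd b \<Longrightarrow> of_int a / of_int b \<in> Z"
  by (auto simp: padic_integral_def)

lemma Z_cases: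
  assumes "x \<in> Z"
  obtains a b where "x = of_int a / of_int b" "\<not> int p dvd b" "b \<noteq> 0"
proof -
  obtain a b where "x = of_int a / of_int b" "\<not> int p dvd b"
    using assms by (auto simp: padic_integral_def)
  moreover from this have "b \<noteq> 0" by auto
  ultimately show ?thesis by (rule that)
qed

lemma Z_of_int [simp]: "of_int a \<in> Z"
  using Z_frac[of 1 a] prime_int not_prime_unit by auto

lemma Z_of_nat [simp]: "of_nat a \<in> Z"
  using Z_of_int[of "int a"] by simp

lemma Z_numeral [simp]: "numeral a \<in> Z"
  using Z_of_int[of "numeral a"] by simp

lemma Z_0 [simp]: "0 \<in> Z"
  using Z_of_int[of 0] by simp

lemma Z_1 [simp]: "1 \<in> Z"
  using Z_of_int[of 1] by simp

lemma Z_add [simp]: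
  assumes "x \<in> Z" "y \<in> Z" shows "x + y \<in> Z"
proof -
  obtain a b where 1: "x = of_int a / of_int b" "\<not> int p dvd b" "b \<noteq> 0"
    using assms(1) by (rule Z_cases)
  obtain c d where 2: "y = of_int c / of_int d" "\<not> int p dvd d" "d \<noteq> 0"
    using assms(2) by (rule Z_cases)
  have "x + y = of_int (a * d + c * b) / of_int (b * d)"
    using 1 2 by (simp add: field_simps)
  then show ?thesis
    using 1 2 prime_int Z_frac by (metis prime_dvd_mult_iff)
qed

lemma Z_mult [simp]:
  assumes "x \<in> Z" "y \<in> Z" shows "x * y \<in> Z"
proof -
  obtain a b where 1: "x = of_int a / of_int b" "\<not> int p dvd b" "b \<noteq> 0"
    using assms(1) by (rule Z_cases)
  obtain c d where 2: "y = of_int c / of_int d" "\<not> int p dvd d" "d \<noteq> 0"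
    using assms(2) by (rule Z_cases)
  have "x * y = of_int (a * c) / of_int (b * d)"
    using 1 2 by (simp add: field_simps)
  then show ?thesis
    using 1 2 prime_int Z_frac by (metis prime_dvd_mult_iff)
qed

lemma Z_uminus [simp]: "x \<in> Z \<Longrightarrow> - x \<in> Z"
  using Z_mult[of "-1" x] Z_of_int[of "-1"] by simp

lemma Z_diff [simp]: "x \<in> Z \<Longrightarrow> y \<in> Z \<Longrightarrow> x - y \<in> Z"
  using Z_add[of x "- y"] by simp

lemma Z_power [simp]: "x \<in> Z \<Longrightarrow> x ^ n \<in> Z"
  by (induction n) auto

lemma Z_sum: "(\<And>i. i \<in> A \<Longrightarrow> f i \<in> Z) \<Longrightarrow> sum f A \<in> Z"
  by (induction A rule: infinite_finite_induct) auto

lemma Z_prod: "(\<And>i. i \<in> A \<Longrightarrow> f i \<in> Z) \<Longrightarrow> prod f A \<in> Z"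
  by (induction A rule: infinite_finite_induct) auto

lemma Z_inverse_of_nat: "\<not> p dvd n \<Longrightarrow> 1 / of_nat n \<in> Z"
  using Z_frac[of "int n" 1] by auto

lemma Z_divide_of_nat: "x \<in> Z \<Longrightarrow> \<not> p dvd n \<Longrightarrow> x / of_nat n \<in> Z"
  using Z_mult[OF _ Z_inverse_of_nat] by fastforce

lemma Id_0_iff [simp]: "x \<in> Id 0 \<longleftrightarrow> x \<in> Z"
  by (simp add: padic_ideal_def)

lemma Id_zero [simp]: "0 \<in> Id i"
  by (auto simp: padic_ideal_def intro: exI[of _ 0])

lemma Id_iff: "x \<in> Id i \<longleftrightarrow> x / of_nat p ^ i \<in> Z"
proof
  assume "x \<in> Id i"
  then show "x / of_nat p ^ i \<in> Z" by (auto simp: padic_ideal_def)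
next
  assume "x / of_nat p ^ i \<in> Z"
  moreover have "x = of_nat p ^ i * (x / of_nat p ^ i)" by simp
  ultimately show "x \<in> Id i" unfolding padic_ideal_def by blast
qed

lemma Id_add: "x \<in> Id i \<Longrightarrow> y \<in> Id i \<Longrightarrow> x + y \<in> Id i"
  by (simp add: Id_iff add_divide_distrib)

lemma Id_uminus: "x \<in> Id i \<Longrightarrow> - x \<in> Id i"
  by (simp add: Id_iff)

lemma Id_diff: "x \<in> Id i \<Longrightarrow> y \<in> Id i \<Longrightarrow> x - y \<in> Id i"
  by (simp add: Id_iff diff_divide_distrib)

lemma Id_sum: "(\<And>k. k \<in> A \<Longrightarrow> f k \<in> Id i) \<Longrightarrow> sum f A \<in> Id i"
  by (induction A rule: infinite_finite_induct) (auto intro: Id_add)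

lemma Id_mult: "x \<in> Id i \<Longrightarrow> y \<in> Id j \<Longrightarrow> x * y \<in> Id (i + j)"
  using Z_mult[of "x / of_nat p ^ i" "y / of_nat p ^ j"] by (simp add: Id_iff power_add)

lemma Id_mult_left: "x \<in> Z \<Longrightarrow> y \<in> Id j \<Longrightarrow> x * y \<in> Id j"
  using Id_mult[of x 0 y j] by simp

lemma Id_mult_right: "y \<in> Id j \<Longrightarrow> x \<in> Z \<Longrightarrow> y * x \<in> Id j"
  using Id_mult_left[of x y j] by (simp add: mult.commute)

lemma Id_of_nat_power [simp]: "of_nat p ^ i \<in> Id i"
  by (simp add: Id_iff)

lemma Id_mono:
  assumes "x \<in> Id i" "j \<le> i" shows "x \<in> Id j"
proof -
  have "x \<in> Id (j + (i - j))" using assms by simp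
  moreover have "x / of_nat p ^ j = of_nat p ^ (i - j) * (x / of_nat p ^ (j + (i - j)))"
    by (simp add: power_add)
  ultimately show ?thesis
    using Id_iff Z_mult Z_power Z_of_nat by metis
qed

lemma Id_subset_Z: "x \<in> Id i \<Longrightarrow> x \<in> Z"
  using Id_mono[of x i 0] by simp

lemma Id_power: "x \<in> Id 1 \<Longrightarrow> x ^ n \<in> Id n"
proof (induction n)
  case (Suc n)
  then show ?case using Id_mult[of x 1 "x ^ n" n] by simp
qed simp

lemma Id_of_int:
  assumes "int p ^ i dvd a" shows "of_int a \<in> Id i"
proof -
  obtain c where "a = int p ^ i * c" using assms by blast
  then have "(of_int a :: rat) = of_nat p ^ i * of_int c" by simp
  then show ?thesis unfolding padic_ideal_def by auto
qed

section \<open>Approximation by natural numbers, units and Euler's theorem\<close>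

lemma approximate_by_nat:
  assumes "z \<in> Z"
  obtains n :: nat where "z - of_nat n \<in> Id i"
proof -
  obtain a b where ab: "z = of_int a / of_int b" "\<not> int p dvd b" "b \<noteq> 0"
    using assms by (rule Z_cases)
  have "coprime b (int p ^ i)"
    using ab prime_int by (meson coprime_commute coprime_power_left_iff prime_imp_coprime)
  then obtain c where c: "[b * c = 1] (mod int p ^ i)"
    using cong_solve_coprime_int by blast
  \<comment> \<open>With \<open>c\<close> inverse to the denominator modulo \<open>p ^ i\<close>,
    the product \<open>a * c\<close> represents \<open>z\<close>; its remainder is a nonnegative
    representative.\<close>
  define n where "n = (a * c) mod int p ^ i"
  have n: "n \<ge> 0" unfolding n_def using prime by (intro pos_mod_sign) (simp add: prime_gt_0_nat)
  have "[b * n = b * (a * c)] (mod int p ^ i)"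
    unfolding n_def by (intro cong_mult cong_refl) (simp add: cong_def)
  also have "[b * (a * c) = a * 1] (mod int p ^ i)"
    using cong_mult[OF cong_refl[of a] c] by (simp add: algebra_simps)
  finally have "int p ^ i dvd a - b * n"
    by (metis cong_iff_dvd_diff cong_sym mult.right_neutral)
  then have "of_int (a - b * n) \<in> Id i" by (rule Id_of_int)
  moreover have "1 / of_int b \<in> Z" using Z_frac[of b 1] ab by simp
  ultimately have "1 / of_int b * of_int (a - b * n) \<in> Id i"
    by (rule Id_mult_left[rotated])
  moreover have "1 / of_int b * of_int (a - b * n) = z - of_nat (nat n)"
    using ab n by (simp add: field_simps)
  ultimately show ?thesis using that by metis
qed

text \<open>The ring is local: a fraction is a unit unless \<open>p\<close> divides its
  numerator.\<close>

lemma unit_or_Id: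
  assumes "x \<in> Z"
  obtains "x \<in> Id 1" | "x \<noteq> 0" "1 / x \<in> Z"
proof -
  obtain a b where ab: "x = of_int a / of_int b" "\<not> int p dvd b" "b \<noteq> 0"
    using assms by (rule Z_cases)
  show ?thesis
  proof (cases "int p dvd a")
    case True
    then have "of_int a \<in> Id 1" by (intro Id_of_int) simp
    moreover have "1 / of_int b \<in> Z" using Z_frac[of b 1] ab by simp
    ultimately have "x \<in> Id 1" using ab Id_mult_left[of "1 / of_int b" "of_int a" 1] by simp
    then show ?thesis by (rule that(1))
  next
    case False
    then have "x \<noteq> 0" "1 / x = of_int b / of_int a" using ab by auto
    then show ?thesis using that(2) Z_frac[of a b] False by metis
  qed
qed

text \<open>Euler's theorem, applied separately to the numerator and the denominator of
  \<open>x\<close>.\<close>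

lemma fermat_euler:
  assumes "x \<noteq> 0" "x \<in> Z" "1 / x \<in> Z"
  shows "x ^ totient (p ^ j) - 1 \<in> Id j"
proof -
  obtain a b where ab: "x = of_int a / of_int b" "\<not> int p dvd b" "b \<noteq> 0"
    using assms(2) by (rule Z_cases)
  \<comment> \<open>Integrality of \<open>1 / x\<close> makes the numerator prime to
    \<open>p\<close>: otherwise \<open>p\<close> would divide the product \<open>b * e\<close> of
    two admissible denominators.\<close>
  have a: "\<not> int p dvd a"
  proof
    assume "int p dvd a"
    then obtain c where c: "a = int p * c" by blast
    obtain d e where de: "1 / x = of_int d / of_int e" "\<not> int p dvd e" "e \<noteq> 0"
      using assms(3) by (rule Z_cases)
    have "of_int b * (of_int e :: rat) = of_int d * of_int a"
      using ab de assms(1) by (auto simp: field_simps)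
    then have "b * e = d * a" by (metis of_int_eq_iff of_int_mult)
    then show False using c ab de prime_int
      by (metis dvd_mult dvd_triv_left prime_dvd_mult_iff)
  qed
  have pw: "[c ^ totient (p ^ j) = 1] (mod int p ^ j)" if "\<not> int p dvd c" for c :: int
  proof -
    have "coprime c (int (p ^ j))"
      using that prime_int by (metis coprime_commute coprime_power_left_iff of_nat_power prime_imp_coprime)
    \<comment> \<open>The locale \<open>residues\<close> requires a modulus above 1; the trivial
      modulus is split off as \<open>j = 0\<close>.\<close>
    moreover have "residues (int (p ^ j))" if "j \<noteq> 0"
      using that prime prime_gt_1_nat by (auto simp: residues_def intro: one_less_power)
    ultimately show ?thesis
      using residues.euler_theorem[of "int (p ^ j)" c] by (cases "j = 0") (auto simp: nat_power_eq)
  qed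
  let ?t = "totient (p ^ j)"
  have "int p ^ j dvd a ^ ?t - b ^ ?t"
    using cong_trans[OF pw[OF a] cong_sym[OF pw[OF ab(2)]]] by (simp add: cong_iff_dvd_diff)
  then have "of_int (a ^ ?t - b ^ ?t) \<in> Id j" by (rule Id_of_int)
  moreover have "(1 / of_int b) ^ ?t \<in> Z" using Z_frac[of b 1] ab by auto
  ultimately have "(1 / of_int b) ^ ?t * of_int (a ^ ?t - b ^ ?t) \<in> Id j"
    by (rule Id_mult_left[rotated])
  moreover have "(1 / of_int b) ^ ?t * of_int (a ^ ?t - b ^ ?t) = x ^ ?t - 1"
    using ab unfolding ab(1) by (simp add: field_simps power_divide)
  ultimately show ?thesis by simp
qed

end

section \<open>Polynomial functions on the p-adic integers\<close>

text \<open>Constants are arbitrary rationals, possibly with \<open>p\<close> in the denominator.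
  The inductive form gives p-adic estimates by induction on the construction, without handling
  coefficients.\<close>

inductive poly_fun :: "(rat \<Rightarrow> rat) \<Rightarrow> bool" where
  poly_fun_const: "poly_fun (\<lambda>x. c)"
| poly_fun_ident: "poly_fun (\<lambda>x. x)"
| poly_fun_add: "poly_fun f \<Longrightarrow> poly_fun g \<Longrightarrow> poly_fun (\<lambda>x. f x + g x)"
| poly_fun_mult: "poly_fun f \<Longrightarrow> poly_fun g \<Longrightarrow> poly_fun (\<lambda>x. f x * g x)"

lemma poly_fun_uminus: "poly_fun f \<Longrightarrow> poly_fun (\<lambda>x. - f x)"
  using poly_fun_mult[OF poly_fun_const[of "-1"], of f] by simp

lemma poly_fun_diff: "poly_fun f \<Longrightarrow> poly_fun g \<Longrightarrow> poly_fun (\<lambda>x. f x - g x)"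
  using poly_fun_add[OF _ poly_fun_uminus, of f g] by simp

lemma poly_fun_divide: "poly_fun f \<Longrightarrow> poly_fun (\<lambda>x. f x / c)"
  using poly_fun_mult[OF poly_fun_const[of "1 / c"], of f] by simp

lemma poly_fun_power: "poly_fun f \<Longrightarrow> poly_fun (\<lambda>x. f x ^ n)"
  by (induction n) (auto intro: poly_fun.intros)

lemma poly_fun_sum: "(\<And>i. i \<in> A \<Longrightarrow> poly_fun (f i)) \<Longrightarrow> poly_fun (\<lambda>x. \<Sum>i\<in>A. f i x)"
  by (induction A rule: infinite_finite_induct) (auto intro: poly_fun.intros)

lemma poly_fun_prod: "(\<And>i. i \<in> A \<Longrightarrow> poly_fun (f i)) \<Longrightarrow> poly_fun (\<lambda>x. \<Prod>i\<in>A. f i x)"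
  by (induction A rule: infinite_finite_induct) (auto intro: poly_fun.intros)

lemmas poly_fun_intros = poly_fun.intros poly_fun_uminus poly_fun_diff poly_fun_divide
  poly_fun_power poly_fun_sum poly_fun_prod

context padic
begin

lemma bounded_denominator: "\<exists>e. of_nat p ^ e * (c :: rat) \<in> Z"
proof -
  obtain a b where c: "c = of_int a / of_int b" "b > 0"
    by (metis quotient_of_denom_pos quotient_of_div surj_pair)
  obtain e d where "b = int p ^ e * d" "\<not> int p dvd d"
    by (metis c(2) less_int_code(1) multiplicity_decompose' not_prime_unit prime_int)
  then have "of_nat p ^ e * c = of_int a / of_int d" "\<not> int p dvd d"
    using c by (auto simp: field_simps)
  then show ?thesis using Z_frac by metis
qed

text \<open>One power of \<open>p\<close> bounds the denominators of all values and serves as a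
  Lipschitz constant. The bound on the values belongs to the claim because the induction step for
  products uses it.\<close>

lemma poly_fun_lipschitz:
  assumes "poly_fun f"
  shows "\<exists>e. (\<forall>x\<in>Z. of_nat p ^ e * f x \<in> Z) \<and>
    (\<forall>x\<in>Z. \<forall>y\<in>Z. \<forall>i. x - y \<in> Id i \<longrightarrow> of_nat p ^ e * (f x - f y) \<in> Id i)"
  using assms
proof induction
  case (poly_fun_const c)
  then show ?case using bounded_denominator[of c] by auto
next
  case poly_fun_ident
  then show ?case by (auto intro: exI[of _ 0])
next
  case (poly_fun_add f g)
  then obtain d e where
    d: "\<And>x. x \<in> Z \<Longrightarrow> of_nat p ^ d * f x \<in> Z"
      "\<And>x y i. x \<in> Z \<Longrightarrow> y \<in> Z \<Longrightarrow> x - y \<in> Id i \<Longrightarrow> of_nat p ^ d * (f x - f y) \<in> Id i" and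
    e: "\<And>x. x \<in> Z \<Longrightarrow> of_nat p ^ e * g x \<in> Z"
      "\<And>x y i. x \<in> Z \<Longrightarrow> y \<in> Z \<Longrightarrow> x - y \<in> Id i \<Longrightarrow> of_nat p ^ e * (g x - g y) \<in> Id i"
    by blast
  show ?case
  proof (intro exI[of _ "d + e"] conjI ballI allI impI)
    fix x assume x: "x \<in> Z"
    have "of_nat p ^ (d + e) * (f x + g x) =
        of_nat p ^ e * (of_nat p ^ d * f x) + of_nat p ^ d * (of_nat p ^ e * g x)"
      by (simp add: power_add algebra_simps)
    also have "\<dots> \<in> Z" using x by (intro Z_add Z_mult[OF _ d(1)] Z_mult[OF _ e(1)]) auto
    finally show "of_nat p ^ (d + e) * (f x + g x) \<in> Z" .
  next
    fix x y i assume x: "x \<in> Z" "y \<in> Z" "x - y \<in> Id i"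
    have "of_nat p ^ (d + e) * (f x + g x - (f y + g y)) =
        of_nat p ^ e * (of_nat p ^ d * (f x - f y)) + of_nat p ^ d * (of_nat p ^ e * (g x - g y))"
      by (simp add: power_add algebra_simps)
    also have "\<dots> \<in> Id i"
      using x by (intro Id_add Id_mult_left[OF _ d(2)] Id_mult_left[OF _ e(2)]) auto
    finally show "of_nat p ^ (d + e) * (f x + g x - (f y + g y)) \<in> Id i" .
  qed
next
  case (poly_fun_mult f g)
  then obtain d e where
    d: "\<And>x. x \<in> Z \<Longrightarrow> of_nat p ^ d * f x \<in> Z"
      "\<And>x y i. x \<in> Z \<Longrightarrow> y \<in> Z \<Longrightarrow> x - y \<in> Id i \<Longrightarrow> of_nat p ^ d * (f x - f y) \<in> Id i" and
    e: "\<And>x. x \<in> Z \<Longrightarrow> of_nat p ^ e * g x \<in> Z"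
      "\<And>x y i. x \<in> Z \<Longrightarrow> y \<in> Z \<Longrightarrow> x - y \<in> Id i \<Longrightarrow> of_nat p ^ e * (g x - g y) \<in> Id i"
    by blast
  show ?case
  proof (intro exI[of _ "d + e"] conjI ballI allI impI)
    fix x assume x: "x \<in> Z"
    have "of_nat p ^ (d + e) * (f x * g x) = (of_nat p ^ d * f x) * (of_nat p ^ e * g x)"
      by (simp add: power_add algebra_simps)
    also have "\<dots> \<in> Z" using x by (intro Z_mult[OF d(1) e(1)])
    finally show "of_nat p ^ (d + e) * (f x * g x) \<in> Z" .
  next
    fix x y i assume x: "x \<in> Z" "y \<in> Z" "x - y \<in> Id i"
    \<comment> \<open>The usual splitting of a difference of products: first \<open>g\<close>
      changes with \<open>f x\<close> fixed, then \<open>f\<close> changes with \<open>g y\<close>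
      fixed.\<close>
    have "of_nat p ^ (d + e) * (f x * g x - (f y * g y)) =
        (of_nat p ^ d * f x) * (of_nat p ^ e * (g x - g y)) +
        (of_nat p ^ e * g y) * (of_nat p ^ d * (f x - f y))"
      by (simp add: power_add algebra_simps)
    also have "\<dots> \<in> Id i"
      using x by (intro Id_add Id_mult_left[OF d(1) e(2)] Id_mult_left[OF e(1) d(2)])
    finally show "of_nat p ^ (d + e) * (f x * g x - (f y * g y)) \<in> Id i" .
  qed
qed

lemma poly_fun_uniformly_continuous:
  assumes "poly_fun f"
  obtains j where "\<And>x y. x \<in> Z \<Longrightarrow> y \<in> Z \<Longrightarrow> x - y \<in> Id j \<Longrightarrow> f x - f y \<in> Id i"
proof -
  obtain e where
    e: "\<And>x y j. x \<in> Z \<Longrightarrow> y \<in> Z \<Longrightarrow> x - y \<in> Id j \<Longrightarrow> of_nat p ^ e * (f x - f y) \<in> Id j"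
    using poly_fun_lipschitz[OF assms] by blast
  show ?thesis
  proof (rule that[of "e + i"])
    fix x y assume "x \<in> Z" "y \<in> Z" "x - y \<in> Id (e + i)"
    then have "of_nat p ^ e * (f x - f y) \<in> Id (e + i)" by (rule e)
    then show "f x - f y \<in> Id i"
      by (simp add: Id_iff power_add)
  qed
qed

lemma unit_cancel_Id:
  assumes "\<not> p dvd n" "of_nat n * x \<in> Id j"
  shows "x \<in> Id j"
proof -
  have "1 / of_nat n * (of_nat n * x) \<in> Id j"
    by (rule Id_mult_left[OF Z_inverse_of_nat]) (rule assms)+
  moreover have "n \<noteq> 0" using assms(1) by (metis dvd_0_right)
  ultimately show ?thesis by simp
qed

text \<open>The shift by the odd number \<open>p ^ i\<close> changes the sign of \<open>f\<close>, but by continuity it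
  hardly changes \<open>f\<close> when \<open>i\<close> is large.\<close>

lemma alternating_poly_fun_Id:
  assumes odd: "odd p" and f: "poly_fun f"
    and alt: "\<And>x. x \<in> Z \<Longrightarrow> f x + f (x - 1) \<in> Id j" and x: "x \<in> Z"
  shows "f x \<in> Id j"
proof -
  have shift: "f x - (-1) ^ n * f (x - of_nat n) \<in> Id j" if "x \<in> Z" for x n
    using that
  proof (induction n arbitrary: x)
    case (Suc n)
    have "f (x - 1) - (-1) ^ n * f (x - 1 - of_nat n) \<in> Id j"
      using Suc by (intro Suc.IH) auto
    then have "(f x + f (x - 1)) - (f (x - 1) - (-1) ^ n * f (x - 1 - of_nat n)) \<in> Id j"
      using Suc.prems by (intro Id_diff[OF alt])
    then show ?case by (simp add: algebra_simps)
  qed simp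
  obtain i where i: "\<And>x y. x \<in> Z \<Longrightarrow> y \<in> Z \<Longrightarrow> x - y \<in> Id i \<Longrightarrow> f x - f y \<in> Id j"
    using poly_fun_uniformly_continuous[OF f] by blast
  have "f x + f (x - of_nat (p ^ i)) \<in> Id j"
    using shift[OF x, of "p ^ i"] odd by simp
  moreover have "f x - f (x - of_nat (p ^ i)) \<in> Id j"
    using x by (intro i) auto
  ultimately have "(f x + f (x - of_nat (p ^ i))) + (f x - f (x - of_nat (p ^ i))) \<in> Id j"
    by (rule Id_add)
  then have "of_nat 2 * f x \<in> Id j" by simp
  moreover have "\<not> p dvd 2"
    using odd prime by (metis primes_dvd_imp_eq two_is_prime_nat even_numeral)
  ultimately show ?thesis by (rule unit_cancel_Id[rotated])
qed

text \<open>Being invariant under the shift by \<open>1\<close>, the function \<open>f\<close> is constant by continuity.\<close>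

lemma periodic_odd_poly_fun_Id:
  assumes odd: "odd p" and f: "poly_fun f"
    and per: "\<And>x. x \<in> Z \<Longrightarrow> f x - f (x - 1) \<in> Id j"
    and refl: "\<And>x. f (- 1 - x) = - f x" and x: "x \<in> Z"
  shows "f x \<in> Id j"
proof -
  have shift: "f x - f (x - of_nat n) \<in> Id j" if "x \<in> Z" for x n
    using that
  proof (induction n arbitrary: x)
    case (Suc n)
    have "f (x - 1) - f (x - 1 - of_nat n) \<in> Id j"
      using Suc by (intro Suc.IH) auto
    then have "(f x - f (x - 1)) + (f (x - 1) - f (x - 1 - of_nat n)) \<in> Id j"
      using Suc.prems by (intro Id_add[OF per])
    then show ?case by (simp add: algebra_simps)
  qed simp
  obtain i where i: "\<And>x y. x \<in> Z \<Longrightarrow> y \<in> Z \<Longrightarrow> x - y \<in> Id i \<Longrightarrow> f x - f y \<in> Id j"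
    using poly_fun_uniformly_continuous[OF f] by blast
  have "2 * x + 1 \<in> Z" using x by simp
  then obtain n where n: "2 * x + 1 - of_nat n \<in> Id i"
    by (rule approximate_by_nat)
  \<comment> \<open>Since \<open>n\<close> approximates \<open>2 * x + 1\<close>, the shifted point
    \<open>x - n\<close> is close to the reflected point \<open>- 1 - x\<close>. Shift invariance
    and oddness then leave \<open>2 * f x\<close> in the ideal.\<close>
  have "f (x - of_nat n) - f (- 1 - x) \<in> Id j"
    using x n by (intro i) (auto simp: algebra_simps)
  with shift[OF x, of n] have "f x - f (x - of_nat n) + (f (x - of_nat n) - f (- 1 - x)) \<in> Id j"
    by (rule Id_add)
  then have "of_nat 2 * f x \<in> Id j" by (simp add: refl)
  moreover have "\<not> p dvd 2"
    using odd prime by (metis primes_dvd_imp_eq two_is_prime_nat even_numeral)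
  ultimately show ?thesis by (rule unit_cancel_Id[rotated])
qed

end


section \<open>The hypergeometric coefficients\<close>

text \<open>This is \<open>(x gchoose k) * ((-1 - x) gchoose k)\<close>.\<close>

definition hyp_coeff :: "rat \<Rightarrow> nat \<Rightarrow> rat" where
  "hyp_coeff x k = (\<Prod>i<k. (of_nat i - x) * (of_nat i + 1 + x) / of_nat (Suc i) ^ 2)"

text \<open>These are the partial products of Euler's product for
  \<open>sin (pi * x) / (pi * x)\<close>.\<close>

definition sine_prod :: "rat \<Rightarrow> nat \<Rightarrow> rat" where
  "sine_prod x n = (\<Prod>i<n. 1 - x ^ 2 / of_nat (Suc i) ^ 2)"

lemma hyp_coeff_0 [simp]: "hyp_coeff x 0 = 1"
  by (simp add: hyp_coeff_def)

lemma hyp_coeff_Suc: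
  "hyp_coeff x (Suc k) =
     hyp_coeff x k * ((of_nat k - x) * (of_nat k + 1 + x) / of_nat (Suc k) ^ 2)"
  by (simp add: hyp_coeff_def)

lemma sine_prod_0 [simp]: "sine_prod x 0 = 1"
  by (simp add: sine_prod_def)

lemma sine_prod_Suc: "sine_prod x (Suc n) = sine_prod x n * (1 - x ^ 2 / of_nat (Suc n) ^ 2)"
  by (simp add: sine_prod_def)

lemma hyp_coeff_reflect: "hyp_coeff (- 1 - x) k = hyp_coeff x k"
  unfolding hyp_coeff_def by (intro prod.cong) (auto simp: field_simps)

lemma of_nat_Suc_nonzero_rat: "(of_nat k + 1 :: rat) \<noteq> 0" "(1 + of_nat k :: rat) \<noteq> 0"
  using of_nat_0_less_iff[of "Suc k", where ?'a = rat] by (auto simp: add.commute simp del: of_nat_0_less_iff)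

text \<open>Regrouping the numerators: \<open>i - x\<close> and \<open>i + x\<close> pair up for
  \<open>1 \<le> i \<le> k\<close>, and only \<open>- x\<close> and \<open>x + k + 1\<close> stay
  unpaired.\<close>

lemma hyp_coeff_Suc_sine_prod:
  "hyp_coeff x (Suc k) = - x * (x + of_nat k + 1) / of_nat (Suc k) ^ 2 * sine_prod x k"
proof (induction k)
  case 0
  then show ?case by (simp add: hyp_coeff_Suc algebra_simps)
next
  case (Suc k)
  have "(of_nat k + 1 :: rat) \<noteq> 0" "(of_nat k + 2 :: rat) \<noteq> 0"
    using of_nat_Suc_nonzero_rat[of k] of_nat_Suc_nonzero_rat[of "Suc k"] by (simp_all add: algebra_simps)
  then show ?case
    unfolding hyp_coeff_Suc[of x "Suc k"] Suc.IH sine_prod_Suc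
    by (simp add: divide_simps) (simp add: algebra_simps power2_eq_square power4_eq_xxxx)
qed

text \<open>The same pairing after the shift; here \<open>x\<close> and \<open>k + 1 - x\<close>
  stay unpaired.\<close>

lemma hyp_coeff_shift_Suc_sine_prod:
  "hyp_coeff (x - 1) (Suc k) = (of_nat k + 1 - x) * x / of_nat (Suc k) ^ 2 * sine_prod x k"
proof (induction k)
  case 0
  then show ?case by (simp add: hyp_coeff_Suc algebra_simps)
next
  case (Suc k)
  have "(of_nat k + 1 :: rat) \<noteq> 0" "(of_nat k + 2 :: rat) \<noteq> 0"
    using of_nat_Suc_nonzero_rat[of k] of_nat_Suc_nonzero_rat[of "Suc k"] by (simp_all add: algebra_simps)
  then show ?case
    unfolding hyp_coeff_Suc[of "x - 1" "Suc k"] Suc.IH sine_prod_Suc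
    by (simp add: divide_simps) (simp add: algebra_simps power2_eq_square power4_eq_xxxx)
qed

text \<open>The unpaired factors add up to
  \<open>- x * (x + k + 1) + x * (k + 1 - x) = - 2 * x ^ 2\<close>. The result is twice the
  increment of \<open>sine_prod x\<close> from \<open>k\<close> to \<open>k + 1\<close>, which is
  what makes summation by parts work.\<close>

lemma hyp_coeff_add_shift:
  "hyp_coeff x (Suc k) + hyp_coeff (x - 1) (Suc k) =
     - 2 * x ^ 2 / of_nat (Suc k) ^ 2 * sine_prod x k"
  unfolding hyp_coeff_Suc_sine_prod[of x k] hyp_coeff_shift_Suc_sine_prod
  using of_nat_Suc_nonzero_rat[of k] by (simp add: divide_simps) (simp add: algebra_simps power2_eq_square power4_eq_xxxx)

lemma hyp_coeff_ratio:
  "(x + of_nat k) * hyp_coeff (x - 1) k = (x - of_nat k) * hyp_coeff x k"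
proof (induction k)
  case (Suc k)
  show ?case unfolding hyp_coeff_Suc_sine_prod[of x k] hyp_coeff_shift_Suc_sine_prod
    by (simp add: algebra_simps)
qed simp

text \<open>After multiplication by \<open>2 * k + 1\<close> this is \<open>hyp_coeff_ratio\<close>;
  the prefactor \<open>2 * x + 1\<close> is chosen to match the denominator in this way.\<close>

lemma hyp_coeff_odd_shift:
  "(2 * x + 1) * (hyp_coeff x k / of_nat (2 * k + 1))
     - (2 * (x - 1) + 1) * (hyp_coeff (x - 1) k / of_nat (2 * k + 1)) =
   hyp_coeff x k + hyp_coeff (x - 1) k"
proof -
  define n :: rat where "n = of_nat (2 * k + 1)"
  have "n \<noteq> 0" unfolding n_def by (subst of_nat_eq_0_iff) simp
  moreover have "(2 * x + 1) * hyp_coeff x k - (2 * (x - 1) + 1) * hyp_coeff (x - 1) k =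
      (hyp_coeff x k + hyp_coeff (x - 1) k) * n"
    unfolding n_def using hyp_coeff_ratio[of x k] by (simp add: algebra_simps)
  ultimately show ?thesis
    unfolding n_def[symmetric] by (simp add: diff_divide_distrib[symmetric])
qed

section \<open>Second-order harmonic numbers and summation by parts\<close>

lemma harmonic2_0 [simp]: "harmonic2 0 = 0"
  by (simp add: harmonic2_def)

lemma harmonic2_Suc: "harmonic2 (Suc n) = harmonic2 n + 1 / of_nat (Suc n) ^ 2"
proof -
  have "{0<..Suc n} = insert (Suc n) {0<..n}" by auto
  then show ?thesis by (simp add: harmonic2_def)
qed

text \<open>Abel summation: the coefficients are twice the increments of \<open>sine_prod x\<close>,
  and the increments \<open>1 / k ^ 2\<close> of \<open>harmonic2\<close>, multiplied by
  \<open>x ^ 2 * sine_prod x (k - 1)\<close>, telescope once more.\<close>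

lemma hyp_coeff_harmonic2_sum:
  "x ^ 2 * (\<Sum>k<Suc n. (hyp_coeff x k + hyp_coeff (x - 1) k) * harmonic2 k) + 2 =
     2 * sine_prod x n * (1 + x ^ 2 * harmonic2 n)"
proof (induction n)
  case (Suc n)
  define s where "s = (\<Sum>k<Suc n. (hyp_coeff x k + hyp_coeff (x - 1) k) * harmonic2 k)"
  have IH: "x ^ 2 * s + 2 = 2 * sine_prod x n * (1 + x ^ 2 * harmonic2 n)"
    using Suc by (simp add: s_def)
  have "x ^ 2 * (\<Sum>k<Suc (Suc n). (hyp_coeff x k + hyp_coeff (x - 1) k) * harmonic2 k) + 2 =
      2 * sine_prod x n * (1 + x ^ 2 * harmonic2 n) +
      x ^ 2 * (- 2 * x ^ 2 / of_nat (Suc n) ^ 2 * sine_prod x n) * harmonic2 (Suc n)"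
    unfolding sum.lessThan_Suc[of _ "Suc n"] s_def[symmetric] hyp_coeff_add_shift IH[symmetric]
    by (simp add: algebra_simps)
  also have "\<dots> = 2 * sine_prod x (Suc n) * (1 + x ^ 2 * harmonic2 (Suc n))"
    unfolding sine_prod_Suc harmonic2_Suc
    using of_nat_Suc_nonzero_rat[of n] by (simp add: divide_simps) (simp add: algebra_simps power2_eq_square power4_eq_xxxx)
  finally show ?case .
qed simp

section \<open>Binomial products as hypergeometric coefficients\<close>

lemma of_nat_choose_mult_choose:
  assumes "l \<le> m" "m \<le> n"
  shows "(of_nat ((n choose m) * (m choose l)) :: rat) =
    fact n / (fact (n - m) * fact l * fact (m - l))"
  using assms by (simp add: binomial_fact)

lemma fact_mult_Suc_2:
  "fact (2 * Suc k) = (2 * of_nat k + 2) * (2 * of_nat k + 1) * (fact (2 * k) :: rat)"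
proof -
  have "2 * Suc k = Suc (Suc (2 * k))" by simp
  then show ?thesis by (simp only: fact_Suc of_nat_Suc of_nat_mult) (simp add: algebra_simps)
qed

lemma fact_mult_Suc_3:
  "fact (3 * Suc k) = (3 * of_nat k + 3) * (3 * of_nat k + 2) * (3 * of_nat k + 1) * (fact (3 * k) :: rat)"
proof -
  have "3 * Suc k = Suc (Suc (Suc (3 * k)))" by simp
  then show ?thesis by (simp only: fact_Suc of_nat_Suc of_nat_mult) (simp add: algebra_simps)
qed

lemma fact_mult_Suc_4:
  "fact (4 * Suc k) = (4 * of_nat k + 4) * (4 * of_nat k + 3) * (4 * of_nat k + 2) * (4 * of_nat k + 1) * (fact (4 * k) :: rat)"
proof -
  have "4 * Suc k = Suc (Suc (Suc (Suc (4 * k))))" by simp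
  then show ?thesis by (simp only: fact_Suc of_nat_Suc of_nat_mult) (simp add: algebra_simps)
qed

lemma fact_mult_Suc_6:
  "fact (6 * Suc k) = (6 * of_nat k + 6) * (6 * of_nat k + 5) * (6 * of_nat k + 4) * (6 * of_nat k + 3) * (6 * of_nat k + 2) * (6 * of_nat k + 1) * (fact (6 * k) :: rat)"
proof -
  have "6 * Suc k = Suc (Suc (Suc (Suc (Suc (Suc (6 * k))))))" by simp
  then show ?thesis by (simp only: fact_Suc of_nat_Suc of_nat_mult) (simp add: algebra_simps)
qed

text \<open>Both sides are 1 at \<open>k = 0\<close> and have the same ratio of consecutive terms,
  here \<open>(4 * k + 1) * (4 * k + 3) / (16 * (k + 1) ^ 2)\<close>. The three companion identities
  are proved in the same way.\<close>

lemma choose_mult_4: "of_nat ((4*k choose 2*k) * (2*k choose k)) / 64^k = hyp_coeff (-1/4) k"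
proof -
  have "fact (4 * k) / (fact (2 * k) * fact k * fact k) / 64 ^ k = hyp_coeff (-1/4) k"
  proof (induction k)
    case (Suc k)
    show ?case
      unfolding hyp_coeff_Suc Suc.IH[symmetric] fact_mult_Suc_2 fact_mult_Suc_3 fact_mult_Suc_4
        fact_mult_Suc_6 fact_Suc power_Suc
      using of_nat_Suc_nonzero_rat[of k] of_nat_Suc_nonzero_rat[of "2 * k"]
      by (simp add: divide_simps) (simp add: algebra_simps power2_eq_square power4_eq_xxxx)
  qed simp
  then show ?thesis by (subst of_nat_choose_mult_choose) simp_all
qed

lemma choose_mult_2: "of_nat ((2*k choose k)^2) / 16^k = hyp_coeff (-1/2) k"
proof -
  have "(fact (2 * k) / (fact k * fact k)) ^ 2 / 16 ^ k = hyp_coeff (-1/2) k"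
  proof (induction k)
    case (Suc k)
    show ?case
      unfolding hyp_coeff_Suc Suc.IH[symmetric] fact_mult_Suc_2 fact_mult_Suc_3 fact_mult_Suc_4
        fact_mult_Suc_6 fact_Suc power_Suc
      using of_nat_Suc_nonzero_rat[of k]
      by (simp add: divide_simps) (simp add: algebra_simps power2_eq_square power4_eq_xxxx)
  qed simp
  then show ?thesis by (simp add: binomial_fact)
qed

lemma choose_mult_3: "of_nat ((2*k choose k) * (3*k choose k)) / 27^k = hyp_coeff (-1/3) k"
proof -
  have "fact (3 * k) / (fact k * fact k * fact k) / 27 ^ k = hyp_coeff (-1/3) k"
  proof (induction k)
    case (Suc k)
    show ?case
      unfolding hyp_coeff_Suc Suc.IH[symmetric] fact_mult_Suc_2 fact_mult_Suc_3 fact_mult_Suc_4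
        fact_mult_Suc_6 fact_Suc power_Suc
      using of_nat_Suc_nonzero_rat[of k]
      by (simp add: divide_simps) (simp add: algebra_simps power2_eq_square power4_eq_xxxx)
  qed simp
  then show ?thesis by (simp add: binomial_fact field_simps)
qed

lemma choose_mult_6: "of_nat ((6*k choose 3*k) * (3*k choose k)) / 432^k = hyp_coeff (-1/6) k"
proof -
  have "fact (6 * k) / (fact (3 * k) * fact k * fact (2 * k)) / 432 ^ k = hyp_coeff (-1/6) k"
  proof (induction k)
    case (Suc k)
    show ?case
      unfolding hyp_coeff_Suc Suc.IH[symmetric] fact_mult_Suc_2 fact_mult_Suc_3 fact_mult_Suc_4
        fact_mult_Suc_6 fact_Suc power_Suc
      using of_nat_Suc_nonzero_rat[of k] of_nat_Suc_nonzero_rat[of "2 * k"]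
        of_nat_Suc_nonzero_rat[of "3 * k"]
      by (simp add: divide_simps) (simp add: algebra_simps power2_eq_square power4_eq_xxxx)
  qed simp
  then show ?thesis by (subst of_nat_choose_mult_choose) simp_all
qed


section \<open>Euler and Bernoulli polynomials\<close>

text \<open>The Taylor expansion of an Appell sequence: the coefficients in powers of
  \<open>x\<close> are the values at \<open>y\<close> of the polynomials built from the same
  \<open>a\<close>.\<close>

lemma sum_binomial_power_add:
  fixes a :: "nat \<Rightarrow> rat"
  shows "(\<Sum>k\<le>n. of_nat (n choose k) * a k * (x + y) ^ (n - k)) =
    (\<Sum>s\<le>n. of_nat (n choose s) * x ^ (n - s) *
      (\<Sum>k\<le>s. of_nat (s choose k) * a k * y ^ (s - k)))"
proof -
  let ?g = "\<lambda>k j. of_nat (n choose k) * a k * (of_nat (n - k choose j) * y ^ j * x ^ (n - k - j))"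
  have "(\<Sum>k\<le>n. of_nat (n choose k) * a k * (x + y) ^ (n - k)) =
      (\<Sum>k\<le>n. \<Sum>j\<le>n - k. ?g k j)"
    by (subst add.commute) (simp add: binomial_ring sum_distrib_left)
  also have "\<dots> = (\<Sum>(k, j)\<in>{(k, j). k + j \<le> n}. ?g k j)"
    by (subst sum.Sigma) (auto intro!: sum.cong)
  also have "\<dots> = (\<Sum>s\<le>n. \<Sum>k\<le>s. ?g k (s - k))"
    by (rule sum.triangle_reindex_eq)
  also have "\<dots> = (\<Sum>s\<le>n. of_nat (n choose s) * x ^ (n - s) *
      (\<Sum>k\<le>s. of_nat (s choose k) * a k * y ^ (s - k)))"
    unfolding sum_distrib_left
  proof (intro sum.cong refl)
    fix s k assume "s \<in> {..n}" "k \<in> {..s}"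
    then have le: "k \<le> s" "s \<le> n" by auto
    have "of_nat (n choose k) * of_nat (n - k choose (s - k)) =
        (of_nat (n choose s) * of_nat (s choose k) :: rat)"
      using choose_mult[OF le] by (metis of_nat_mult)
    moreover have "n - k - (s - k) = n - s" using le by simp
    ultimately show "?g k (s - k) =
        of_nat (n choose s) * x ^ (n - s) * (of_nat (s choose k) * a k * y ^ (s - k))"
      by (simp add: mult_ac)
  qed
  finally show ?thesis .
qed

text \<open>The coefficientwise form of \<open>cosh\<close> times \<open>1 / cosh\<close> being
  1.\<close>

lemma euler_num_sum:
  "(\<Sum>k\<le>n. if even (n - k) then of_nat (n choose k) * euler_num k else 0) = (if n = 0 then 1 else 0)"
proof (cases "n = 0")
  case True
  then show ?thesis by (simp add: euler_num.simps[of 0])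
next
  case False
  then show ?thesis
    using euler_num.simps[of n] by (simp add: lessThan_Suc_atMost[symmetric])
qed

text \<open>Expanding both values about \<open>x\<close> gives offsets \<open>1 / 2\<close> and
  \<open>- 1 / 2\<close>. Odd powers of the offsets cancel, and the even ones form the recurrence of
  the Euler numbers, which vanishes except in degree 0.\<close>

lemma euler_poly_add_one: "euler_poly n (x + 1) + euler_poly n x = 2 * x ^ n"
proof -
  let ?a = "\<lambda>k. euler_num k / 2 ^ k"
  have inner: "(\<Sum>k\<le>s. of_nat (s choose k) * ?a k * (1 / 2) ^ (s - k)) +
      (\<Sum>k\<le>s. of_nat (s choose k) * ?a k * (- 1 / 2) ^ (s - k)) = (if s = 0 then 2 else 0)"
    (is "?l = _") for s
  proof -
    have "?l = (\<Sum>k\<le>s. 2 / 2 ^ s *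
        (if even (s - k) then of_nat (s choose k) * euler_num k else 0))"
      unfolding sum.distrib[symmetric]
    proof (intro sum.cong refl)
      fix k assume "k \<in> {..s}"
      then have "(2 :: rat) ^ s = 2 ^ k * 2 ^ (s - k)" by (simp flip: power_add)
      then show "of_nat (s choose k) * ?a k * (1 / 2) ^ (s - k) +
          of_nat (s choose k) * ?a k * (- 1 / 2) ^ (s - k) =
          2 / 2 ^ s * (if even (s - k) then of_nat (s choose k) * euler_num k else 0)"
        by (cases "even (s - k)") (auto simp: power_divide)
    qed
    also have "\<dots> = 2 / 2 ^ s * (if s = 0 then 1 else 0)"
      unfolding sum_distrib_left[symmetric] euler_num_sum ..
    finally show ?thesis by simp
  qed
  have "euler_poly n (x + 1) + euler_poly n x =
      (\<Sum>k\<le>n. of_nat (n choose k) * ?a k * (x + 1 / 2) ^ (n - k)) +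
      (\<Sum>k\<le>n. of_nat (n choose k) * ?a k * (x + (- 1 / 2)) ^ (n - k))"
    unfolding euler_poly_def by (simp add: algebra_simps)
  also have "\<dots> = (\<Sum>s\<le>n. of_nat (n choose s) * x ^ (n - s) * (if s = 0 then 2 else 0))"
    unfolding sum_binomial_power_add inner[symmetric] by (simp only: distrib_left sum.distrib)
  also have "\<dots> = (\<Sum>s\<le>n. if s = 0 then 2 * x ^ n else 0)"
    by (intro sum.cong) auto
  finally show ?thesis by simp
qed

lemma euler_poly_half: "euler_poly n (1 / 2) = euler_num n / 2 ^ n"
proof -
  have "euler_poly n (1 / 2) = (\<Sum>k\<le>n. if k = n then euler_num n / 2 ^ n else 0)"
    unfolding euler_poly_def by (intro sum.cong) (auto simp: power_0_left)
  then show ?thesis by simp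
qed

section \<open>Bernoulli numbers and Bernoulli polynomials\<close>

lemma bernoulli_num_0 [simp]: "bernoulli_num 0 = 1"
  by (subst bernoulli_num.simps) simp

text \<open>The top term of the sum cancels against \<open>a (Suc n)\<close>, and \<open>a n\<close>
  has the nonzero coefficient \<open>Suc n\<close>. Stated for arbitrary \<open>a\<close> to serve
  both the Bernoulli numbers and their uniqueness.\<close>

lemma bernoulli_num_rec_iff:
  fixes a :: "nat \<Rightarrow> rat"
  assumes "n > 0"
  shows "(\<Sum>k\<le>Suc n. of_nat (Suc n choose k) * a k) = a (Suc n) \<longleftrightarrow>
    a n = - (\<Sum>k<n. of_nat (Suc n choose k) * a k) / of_nat (Suc n)"
proof -
  have "(\<Sum>k\<le>Suc n. of_nat (Suc n choose k) * a k) =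
      (\<Sum>k<n. of_nat (Suc n choose k) * a k) + of_nat (Suc n) * a n + a (Suc n)"
    unfolding lessThan_Suc_atMost[symmetric] by simp
  moreover have "(of_nat (Suc n) :: rat) \<noteq> 0" by (simp only: of_nat_eq_0_iff)
  ultimately show ?thesis
    by (simp add: field_simps eq_neg_iff_add_eq_0 del: of_nat_Suc binomial_Suc_Suc)
qed

text \<open>The left side is the Bernoulli polynomial at 1, which differs from its value at 0 only
  in degree 1.\<close>

lemma bernoulli_num_sum:
  "(\<Sum>k\<le>n. of_nat (n choose k) * bernoulli_num k) = bernoulli_num n + (if n = 1 then 1 else 0)"
proof (cases "n \<le> 1")
  case True
  then consider "n = 0" | "n = Suc 0" by force
  then show ?thesis by cases simp_all
next
  case False
  then obtain m where m: "n = Suc m" "m > 0" by (cases n) auto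
  have "bernoulli_num m =
      - (\<Sum>k<m. of_nat (Suc m choose k) * bernoulli_num k) / of_nat (Suc m)"
    using m(2) by (subst bernoulli_num.simps) simp
  then have "(\<Sum>k\<le>Suc m. of_nat (Suc m choose k) * bernoulli_num k) = bernoulli_num (Suc m)"
    by (rule bernoulli_num_rec_iff[OF m(2), THEN iffD2])
  with m show ?thesis by simp
qed

text \<open>At index \<open>Suc n\<close> the identity determines \<open>a n\<close> from the
  earlier values. It serves to prove the reflection symmetry without generating functions.\<close>

lemma bernoulli_num_unique:
  assumes "a 0 = 1"
    and a: "\<And>n. (\<Sum>k\<le>n. of_nat (n choose k) * a k) = a n + (if n = 1 then 1 else 0)"
  shows "a n = bernoulli_num n"
proof (induction n rule: less_induct)
  case (less n)
  show ?case
  proof (cases "n = 0")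
    case False
    then have "a n = - (\<Sum>k<n. of_nat (Suc n choose k) * a k) / of_nat (Suc n)"
      using a[of "Suc n"] by (intro bernoulli_num_rec_iff[THEN iffD1]) auto
    also have "(\<Sum>k<n. of_nat (Suc n choose k) * a k) =
        (\<Sum>k<n. of_nat (Suc n choose k) * bernoulli_num k)"
      using less by (intro sum.cong) auto
    also have "- (\<Sum>k<n. of_nat (Suc n choose k) * bernoulli_num k) / of_nat (Suc n) = bernoulli_num n"
      using False by (subst (2) bernoulli_num.simps) simp
    finally show ?thesis .
  qed (simp add: assms(1))
qed

lemma bernoulli_poly_add_one_expand:
  "bernoulli_poly n (x + 1) =
     (\<Sum>s\<le>n. of_nat (n choose s) * (bernoulli_num s + (if s = 1 then 1 else 0)) * x ^ (n - s))"
  unfolding bernoulli_poly_def sum_binomial_power_add power_one mult_1_right bernoulli_num_sum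
  by (simp only: mult_ac)

lemma bernoulli_poly_add_one:
  "bernoulli_poly n (x + 1) - bernoulli_poly n x = of_nat n * x ^ (n - 1)"
proof -
  have "bernoulli_poly n (x + 1) - bernoulli_poly n x =
      (\<Sum>s\<le>n. if s = 1 then of_nat n * x ^ (n - 1) else 0)"
    unfolding bernoulli_poly_add_one_expand unfolding bernoulli_poly_def sum_subtractf[symmetric]
    by (intro sum.cong) (auto simp: algebra_simps)
  then show ?thesis by (cases n) auto
qed

lemma bernoulli_poly_0: "bernoulli_poly n 0 = bernoulli_num n"
proof -
  have "bernoulli_poly n 0 = (\<Sum>k\<le>n. if k = n then bernoulli_num n else 0)"
    unfolding bernoulli_poly_def by (intro sum.cong) (auto simp: power_0_left)
  then show ?thesis by simp
qed

lemma minus_one_power_diff: "k \<le> n \<Longrightarrow> (- 1 :: rat) ^ (n - k) = (- 1) ^ n * (- 1) ^ k"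
  using power_add[of "- 1 :: rat" "n - k" k] by (simp add: mult.assoc)

text \<open>The left side satisfies the characterising identity, since its binomial sum is
  \<open>(- 1) ^ n\<close> times the Bernoulli polynomial at \<open>- 1 + 1 = 0\<close>. The content
  is that the Bernoulli numbers of odd index above 1 vanish.\<close>

lemma bernoulli_num_reflect:
  "(- 1) ^ n * (bernoulli_num n + (if n = 1 then 1 else 0)) = bernoulli_num n"
proof (rule bernoulli_num_unique)
  fix n
  have "(\<Sum>k\<le>n. of_nat (n choose k) * ((- 1) ^ k * (bernoulli_num k + (if k = 1 then 1 else 0)))) =
      (- 1) ^ n * bernoulli_poly n (- 1 + 1)"
    unfolding bernoulli_poly_add_one_expand sum_distrib_left
  proof (intro sum.cong refl)
    fix k assume "k \<in> {..n}"
    then have "(- 1 :: rat) ^ k = (- 1) ^ n * (- 1) ^ (n - k)"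
      by (simp add: minus_one_power_diff mult.assoc[symmetric])
    then show "of_nat (n choose k) * ((- 1) ^ k * (bernoulli_num k + (if k = 1 then 1 else 0))) =
        (- 1) ^ n * (of_nat (n choose k) * (bernoulli_num k + (if k = 1 then 1 else 0)) *
          (- 1) ^ (n - k))"
      by (simp only: mult_ac)
  qed
  also have "\<dots> = (- 1) ^ n * bernoulli_num n" by (simp add: bernoulli_poly_0)
  finally show "(\<Sum>k\<le>n. of_nat (n choose k) * ((- 1) ^ k * (bernoulli_num k + (if k = 1 then 1 else 0)))) =
      (- 1) ^ n * (bernoulli_num n + (if n = 1 then 1 else 0)) + (if n = 1 then 1 else 0)"
    by simp
qed simp

lemma bernoulli_poly_reflect: "bernoulli_poly n (1 - x) = (- 1) ^ n * bernoulli_poly n x"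
proof -
  have "bernoulli_poly n (- x + 1) = (- 1) ^ n * bernoulli_poly n x"
    unfolding bernoulli_poly_add_one_expand unfolding bernoulli_poly_def sum_distrib_left
  proof (intro sum.cong refl)
    fix k assume "k \<in> {..n}"
    then have x: "(- x) ^ (n - k) = (- 1) ^ n * (- 1) ^ k * x ^ (n - k)"
      by (simp add: minus_one_power_diff power_minus[of x])
    define b where "b = bernoulli_num k + (if k = 1 then 1 else 0)"
    have b: "bernoulli_num k = (- 1) ^ k * b"
      unfolding b_def by (rule bernoulli_num_reflect[symmetric])
    show "of_nat (n choose k) * (bernoulli_num k + (if k = 1 then 1 else 0)) * (- x) ^ (n - k) =
        (- 1) ^ n * (of_nat (n choose k) * bernoulli_num k * x ^ (n - k))"
      unfolding x b_def[symmetric] unfolding b by (simp only: mult_ac)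
  qed
  then show ?thesis by simp
qed


lemma poly_fun_euler_poly: "poly_fun f \<Longrightarrow> poly_fun (\<lambda>x. euler_poly n (f x))"
  unfolding euler_poly_def by (intro poly_fun_intros)

lemma poly_fun_bernoulli_poly: "poly_fun f \<Longrightarrow> poly_fun (\<lambda>x. bernoulli_poly n (f x))"
  unfolding bernoulli_poly_def by (intro poly_fun_intros)

section \<open>The harmonic sums as p-adic functions\<close>

definition harmonic_sum :: "nat \<Rightarrow> rat \<Rightarrow> rat" where
  "harmonic_sum p x = (\<Sum>k<p. hyp_coeff x k * harmonic2 k)"

definition odd_harmonic_sum :: "nat \<Rightarrow> rat \<Rightarrow> rat" where
  "odd_harmonic_sum p x = (2 * x + 1) * (\<Sum>k<p. hyp_coeff x k / of_nat (2 * k + 1) * harmonic2 k)"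

lemma poly_fun_harmonic_sum: "poly_fun f \<Longrightarrow> poly_fun (\<lambda>x. harmonic_sum p (f x))"
  unfolding harmonic_sum_def hyp_coeff_def by (intro poly_fun_intros)

lemma poly_fun_odd_harmonic_sum: "poly_fun f \<Longrightarrow> poly_fun (\<lambda>x. odd_harmonic_sum p (f x))"
  unfolding odd_harmonic_sum_def hyp_coeff_def by (intro poly_fun_intros)

lemma harmonic_sum_reflect: "harmonic_sum p (- 1 - x) = harmonic_sum p x"
  by (simp add: harmonic_sum_def hyp_coeff_reflect)

lemma odd_harmonic_sum_reflect: "odd_harmonic_sum p (- 1 - x) = - odd_harmonic_sum p x"
proof -
  have "2 * (- 1 - x) + 1 = - (2 * x + 1)" by simp
  then show ?thesis unfolding odd_harmonic_sum_def hyp_coeff_reflect by (simp only: mult_minus_left)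
qed

lemma odd_harmonic_sum_diff:
  "odd_harmonic_sum p x - odd_harmonic_sum p (x - 1) = harmonic_sum p x + harmonic_sum p (x - 1)"
  unfolding odd_harmonic_sum_def harmonic_sum_def sum_distrib_left
    sum_subtractf[symmetric] sum.distrib[symmetric]
proof (intro sum.cong refl)
  fix k
  show "(2 * x + 1) * (hyp_coeff x k / of_nat (2 * k + 1) * harmonic2 k) -
      (2 * (x - 1) + 1) * (hyp_coeff (x - 1) k / of_nat (2 * k + 1) * harmonic2 k) =
      hyp_coeff x k * harmonic2 k + hyp_coeff (x - 1) k * harmonic2 k"
    unfolding distrib_right[symmetric] hyp_coeff_odd_shift[symmetric]
    by (simp only: left_diff_distrib mult.assoc)
qed

context padic
begin

lemma not_dvd_less: "0 < n \<Longrightarrow> n < p \<Longrightarrow> \<not> p dvd n"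
  by (meson dvd_imp_le not_le)

lemma Z_divide_less: "x \<in> Z \<Longrightarrow> 0 < n \<Longrightarrow> n < p \<Longrightarrow> x / of_nat n ^ i \<in> Z"
  using Z_mult[OF _ Z_power[OF Z_inverse_of_nat[OF not_dvd_less]], of x n i]
  by (simp add: power_divide)

lemma Z_harmonic2: "n < p \<Longrightarrow> harmonic2 n \<in> Z"
  unfolding harmonic2_def by (intro Z_sum Z_divide_less) auto

lemma Z_hyp_coeff: "x \<in> Z \<Longrightarrow> k < p \<Longrightarrow> hyp_coeff x k \<in> Z"
  unfolding hyp_coeff_def by (intro Z_prod Z_divide_less) auto

lemma Z_sine_prod: "x \<in> Z \<Longrightarrow> n < p \<Longrightarrow> sine_prod x n \<in> Z"
  unfolding sine_prod_def by (intro Z_prod Z_divide_less Z_diff) auto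

lemma Z_harmonic_sum: "x \<in> Z \<Longrightarrow> harmonic_sum p x \<in> Z"
  unfolding harmonic_sum_def by (intro Z_sum Z_mult Z_hyp_coeff Z_harmonic2) auto

lemma one_notin_Id: "1 \<notin> Id 1"
proof
  assume "1 \<in> Id 1"
  then have "1 / of_nat p \<in> Z" by (simp add: Id_iff)
  then obtain a b where ab: "1 / of_nat p = (of_int a / of_int b :: rat)" "\<not> int p dvd b" "b \<noteq> 0"
    by (rule Z_cases)
  then have "(of_int b :: rat) = of_int (int p * a)" by (simp add: field_simps)
  then have "b = int p * a" by (metis of_int_eq_iff)
  with ab show False by simp
qed

text \<open>The residue of a unit is one of \<open>1, ..., p - 1\<close>: residue 0 would put
  \<open>1 / x * x = 1\<close> into the ideal.\<close>

lemma unit_residue: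
  assumes "x \<in> Z" "x \<noteq> 0" "1 / x \<in> Z"
  obtains i where "i < p - 1" "of_nat (Suc i) - x \<in> Id 1"
proof -
  obtain n where n: "x - of_nat n \<in> Id 1" using assms(1) by (rule approximate_by_nat)
  have "(of_nat n :: rat) = of_nat (n mod p) + of_nat p * of_nat (n div p)"
    unfolding of_nat_mult[symmetric] of_nat_add[symmetric] by simp
  moreover have "of_nat p * of_nat (n div p) \<in> Id 1"
    using Id_mult_right[OF Id_of_nat_power[of 1], of "of_nat (n div p)"] by simp
  ultimately have *: "x - of_nat (n mod p) \<in> Id 1"
    using Id_add[OF n, of "of_nat p * of_nat (n div p)"] by simp
  have "n mod p \<noteq> 0"
  proof
    assume "n mod p = 0"
    with * have "1 / x * x \<in> Id 1" using assms by (intro Id_mult_left) auto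
    with assms one_notin_Id show False by simp
  qed
  then obtain i where i: "n mod p = Suc i" by (metis not0_implies_Suc)
  moreover have "n mod p < p" using prime prime_gt_0_nat by simp
  moreover have "of_nat (n mod p) - x \<in> Id 1" using Id_uminus[OF *] by simp
  ultimately show ?thesis using that[of i] by simp
qed

lemma prod_Id_1:
  assumes "finite A" "i \<in> A" "f i \<in> Id 1" "\<And>k. k \<in> A \<Longrightarrow> f k \<in> Z"
  shows "prod f A \<in> Id 1"
  unfolding prod.remove[OF assms(1,2)] using assms by (intro Id_mult_right Z_prod) auto

text \<open>The numerators are \<open>(i - x) * (i + x)\<close> for \<open>1 \<le> i < p\<close>. As
  \<open>x\<close> and \<open>- x\<close> are both units, one factor \<open>i - x\<close> and one
  factor \<open>i + x\<close> are divisible by \<open>p\<close>, while the denominators are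
  units.\<close>

lemma sine_prod_Id:
  assumes "x \<in> Z" "x \<noteq> 0" "1 / x \<in> Z"
  shows "sine_prod x (p - 1) \<in> Id 2"
proof -
  let ?n = "p - 1"
  have "(\<Prod>i<?n. of_nat (Suc i) - y) \<in> Id 1" if y: "y \<in> Z" "y \<noteq> 0" "1 / y \<in> Z" for y
  proof -
    obtain i where "i < ?n" "of_nat (Suc i) - y \<in> Id 1"
      using unit_residue[OF y] .
    then show ?thesis using y(1) by (intro prod_Id_1[of _ i]) auto
  qed
  note this[OF assms] this[of "- x"]
  then have "(\<Prod>i<?n. of_nat (Suc i) - x) * (\<Prod>i<?n. of_nat (Suc i) - (- x)) \<in> Id (1 + 1)"
    using assms Z_uminus[of "1 / x"] by (intro Id_mult) auto
  then have "(\<Prod>i<?n. of_nat (Suc i) - x) * (\<Prod>i<?n. of_nat (Suc i) - (- x)) *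
      (\<Prod>i<?n. 1 / of_nat (Suc i) ^ 2) \<in> Id (1 + 1)"
    by (intro Id_mult_right[of "_ * _"] Z_prod Z_divide_less) auto
  also have "(\<Prod>i<?n. of_nat (Suc i) - x) * (\<Prod>i<?n. of_nat (Suc i) - (- x)) *
      (\<Prod>i<?n. 1 / of_nat (Suc i) ^ 2) = sine_prod x ?n"
    unfolding sine_prod_def prod.distrib[symmetric]
  proof (intro prod.cong refl)
    fix i
    have "(of_nat (Suc i) :: rat) \<noteq> 0" by (simp only: of_nat_eq_0_iff)
    then show "(of_nat (Suc i) - x) * (of_nat (Suc i) - - x) * (1 / of_nat (Suc i) ^ 2) =
        1 - x ^ 2 / of_nat (Suc i) ^ 2"
      by (simp add: field_simps power2_eq_square del: of_nat_Suc)
  qed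
  finally show ?thesis by (simp add: numeral_2_eq_2)
qed

end

text \<open>The exponent \<open>m\<close> is chosen such that \<open>x ^ m\<close> is congruent modulo \<open>p ^ j\<close> to
  \<open>1 / x ^ 2\<close> for units \<open>x\<close> and to \<open>0\<close> for non-units.\<close>

locale padic_harmonic = padic +
  fixes j m :: nat
  assumes p_gt_3: "p > 3"
    and j: "j = 1 \<or> j = 2"
    and m: "m = p ^ j - p ^ (j - 1) - 2"
begin

lemma odd_p: "odd p"
  using prime p_gt_3 prime_odd_nat by force

lemma m_totient: "totient (p ^ j) = m + 2" and m_ge: "m \<ge> 2" and even_m: "even m"
proof -
  have j': "p ^ j = p ^ (j - 1) * p" "j > 0" using j by (auto simp: power2_eq_square)
  have t: "totient (p ^ j) = p ^ (j - 1) * (p - 1)"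
    using prime j' by (intro totient_prime_power) auto
  also have "\<dots> = p ^ j - p ^ (j - 1)" by (simp add: j' algebra_simps)
  finally have m': "m = totient (p ^ j) - 2" using m by simp
  have "p - 1 \<ge> 4" using p_gt_3 odd_p by (cases "p = 4") auto
  moreover have "p ^ (j - 1) \<ge> 1" using p_gt_3 by (intro one_le_power) auto
  ultimately have ge: "totient (p ^ j) \<ge> 1 * 4" unfolding t by (intro mult_mono) auto
  then show "totient (p ^ j) = m + 2" "m \<ge> 2" using m' by auto
  moreover have "even (totient (p ^ j))" unfolding t using odd_p by simp
  ultimately show "even m" by simp
qed

lemma j_le_m: "j \<le> m"
  using m_ge j by auto

lemma not_dvd_2: "\<not> p dvd 2" and not_dvd_3: "\<not> p dvd 3" and not_dvd_4: "\<not> p dvd 4"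
proof -
  show "\<not> p dvd 2" "\<not> p dvd 3" by (rule not_dvd_less, use p_gt_3 in auto)+
  then show "\<not> p dvd 4" using prime prime_dvd_mult_iff[of p 2 2] by simp
qed

lemmas Z_inverse_2 = Z_divide_of_nat[OF _ not_dvd_2, simplified]
lemmas Z_inverse_3 = Z_divide_of_nat[OF _ not_dvd_3, simplified]

lemma power_m_unit:
  assumes "x \<in> Z" "x \<noteq> 0" "1 / x \<in> Z"
  shows "x ^ 2 * x ^ m - 1 \<in> Id j"
  using fermat_euler[OF assms(2,1,3), of j] 
  by (simp only: m_totient power_add mult.commute)

text \<open>Modulo \<open>p ^ j\<close> the factor \<open>2 ^ m\<close> in the multiplication
  formulas acts as \<open>1 / 4\<close>; likewise \<open>3 ^ m\<close> acts as
  \<open>1 / 9\<close>.\<close>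

lemma four_mult_power_m: "4 * 2 ^ m - 1 \<in> Id j"
  using power_m_unit[of 2] Z_inverse_2[of 1] by simp

lemma nine_mult_power_m: "9 * 3 ^ m - 1 \<in> Id j"
  using power_m_unit[of 3] Z_inverse_3[of 1] by simp

lemma harmonic_sum_add_shift:
  assumes x: "x \<in> Z"
  shows "harmonic_sum p x + harmonic_sum p (x - 1) + 2 * x ^ m \<in> Id j"
proof -
  define s where "s = (\<Sum>k<p. (hyp_coeff x k + hyp_coeff (x - 1) k) * harmonic2 k)"
  have s: "harmonic_sum p x + harmonic_sum p (x - 1) = s"
    unfolding s_def harmonic_sum_def by (simp add: sum.distrib algebra_simps)
  have j2: "j \<le> 2" using j by auto
  show ?thesis
  proof (cases rule: unit_or_Id[OF x])
    case 1
    \<comment> \<open>For \<open>x\<close> divisible by \<open>p\<close>, each term with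
      \<open>k > 0\<close> carries the factor \<open>x ^ 2\<close>, and
      \<open>harmonic2 0 = 0\<close> removes the term \<open>k = 0\<close>.\<close>
    have "(hyp_coeff x k + hyp_coeff (x - 1) k) * harmonic2 k \<in> Id 2" if "k < p" for k
    proof (cases k)
      case (Suc i)
      have "x ^ 2 * (- 2 / of_nat (Suc i) ^ 2 * sine_prod x i * harmonic2 k) \<in> Id 2"
        using that Suc x
        by (intro Id_mult_right[OF Id_power[OF 1]] Z_mult Z_divide_less Z_sine_prod Z_harmonic2) auto
      also have "x ^ 2 * (- 2 / of_nat (Suc i) ^ 2 * sine_prod x i * harmonic2 k) =
          (hyp_coeff x k + hyp_coeff (x - 1) k) * harmonic2 k"
        unfolding Suc hyp_coeff_add_shift by simp
      finally show ?thesis .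
    qed simp
    then have "s \<in> Id j" unfolding s_def by (intro Id_sum Id_mono[OF _ j2]) auto
    moreover have "2 * x ^ m \<in> Id j"
      by (intro Id_mult_left Id_mono[OF Id_power[OF 1] j_le_m]) auto
    ultimately show ?thesis unfolding s by (rule Id_add)
  next
    case 2
    \<comment> \<open>For a unit \<open>x\<close> the closed form of the sum contains
      \<open>sine_prod x (p - 1)\<close>, which is divisible by \<open>p ^ 2\<close>; hence
      \<open>x ^ 2 * s\<close> is congruent to \<open>- 2\<close>, and \<open>x ^ 2\<close> can be
      cancelled.\<close>
    have "p = Suc (p - 1)" using p_gt_3 by simp
    then have "x ^ 2 * s + 2 = 2 * sine_prod x (p - 1) * (1 + x ^ 2 * harmonic2 (p - 1))"
      using hyp_coeff_harmonic2_sum[of x "p - 1"] unfolding s_def by simp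
    also have "\<dots> \<in> Id 2"
      using x p_gt_3
      by (intro Id_mult_right Id_mult_left sine_prod_Id 2 Z_add Z_mult Z_harmonic2) auto
    finally have "x ^ 2 * s + 2 + 2 * (x ^ 2 * x ^ m - 1) \<in> Id j"
      by (intro Id_add[OF Id_mono[OF _ j2] Id_mult_left[OF _ power_m_unit[OF x 2]]]) auto
    then have "(1 / x) ^ 2 * (x ^ 2 * s + 2 + 2 * (x ^ 2 * x ^ m - 1)) \<in> Id j"
      using 2 by (intro Id_mult_left) auto
    also have "(1 / x) ^ 2 * (x ^ 2 * s + 2 + 2 * (x ^ 2 * x ^ m - 1)) = s + 2 * x ^ m"
      using 2 by (simp add: field_simps)
    finally show ?thesis unfolding s .
  qed
qed

lemma odd_harmonic_sum_shift:
  "x \<in> Z \<Longrightarrow> odd_harmonic_sum p x - odd_harmonic_sum p (x - 1) + 2 * x ^ m \<in> Id j"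
  unfolding odd_harmonic_sum_diff by (rule harmonic_sum_add_shift)

text \<open>Not a termwise fact, because \<open>2 * k + 1 = p\<close> occurs as a denominator. The
  unit differences are integral, so the periodicity argument applies with the ideal
  \<open>Id 0\<close>, which is the whole ring.\<close>

lemma Z_odd_harmonic_sum:
  assumes "x \<in> Z" shows "odd_harmonic_sum p x \<in> Z"
proof -
  have "odd_harmonic_sum p x \<in> Id 0"
  proof (rule periodic_odd_poly_fun_Id[where f = "odd_harmonic_sum p", OF odd_p _ _ _ assms])
    show "odd_harmonic_sum p x - odd_harmonic_sum p (x - 1) \<in> Id 0" if "x \<in> Z" for x
      unfolding odd_harmonic_sum_diff using that by (simp add: Z_harmonic_sum)
  qed (intro poly_fun_odd_harmonic_sum poly_fun_ident odd_harmonic_sum_reflect)+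
  then show ?thesis by simp
qed

text \<open>Adding the values at \<open>x\<close> and \<open>x - 1\<close> makes the Euler
  polynomials contribute exactly the \<open>2 * x ^ m\<close> of
  \<open>harmonic_sum_add_shift\<close>.\<close>

lemma harmonic_sum_euler_poly:
  assumes "x \<in> Z"
  shows "harmonic_sum p x + euler_poly m (x + 1) \<in> Id j"
proof (rule alternating_poly_fun_Id[OF odd_p _ _ assms])
  show "poly_fun (\<lambda>x. harmonic_sum p x + euler_poly m (x + 1))"
    by (intro poly_fun_intros poly_fun_harmonic_sum poly_fun_euler_poly)
  fix x
  have "harmonic_sum p x + euler_poly m (x + 1) + (harmonic_sum p (x - 1) + euler_poly m (x - 1 + 1)) =
      harmonic_sum p x + harmonic_sum p (x - 1) + 2 * x ^ m"
    using euler_poly_add_one[of m x] by simp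
  with harmonic_sum_add_shift[of x]
  show "harmonic_sum p x + euler_poly m (x + 1) +
      (harmonic_sum p (x - 1) + euler_poly m (x - 1 + 1)) \<in> Id j" if "x \<in> Z"
    using that by metis
qed

text \<open>The unit differences cancel modulo \<open>p ^ j\<close>. Since \<open>m + 1\<close> is
  odd, the Bernoulli polynomial at \<open>x + 1\<close> also changes sign under
  \<open>x \<mapsto> - 1 - x\<close>, which fixes the additive constant.\<close>

lemma odd_harmonic_sum_bernoulli_poly:
  assumes "x \<in> Z"
  shows "odd_harmonic_sum p x + 2 / of_nat (m + 1) * bernoulli_poly (m + 1) (x + 1) \<in> Id j"
proof (rule periodic_odd_poly_fun_Id[OF odd_p _ _ _ assms])
  show "poly_fun (\<lambda>x. odd_harmonic_sum p x + 2 / of_nat (m + 1) * bernoulli_poly (m + 1) (x + 1))"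
    by (intro poly_fun_intros poly_fun_odd_harmonic_sum poly_fun_bernoulli_poly)
  fix x
  have "(of_nat (m + 1) :: rat) \<noteq> 0" by (simp only: of_nat_eq_0_iff)
  then have "2 / of_nat (m + 1) * bernoulli_poly (m + 1) (x + 1) -
      2 / of_nat (m + 1) * bernoulli_poly (m + 1) x = 2 * x ^ m"
    unfolding right_diff_distrib[symmetric] bernoulli_poly_add_one by simp
  then have "odd_harmonic_sum p x + 2 / of_nat (m + 1) * bernoulli_poly (m + 1) (x + 1) -
      (odd_harmonic_sum p (x - 1) + 2 / of_nat (m + 1) * bernoulli_poly (m + 1) (x - 1 + 1)) =
      odd_harmonic_sum p x - odd_harmonic_sum p (x - 1) + 2 * x ^ m"
    by simp
  with odd_harmonic_sum_shift[of x]
  show "odd_harmonic_sum p x + 2 / of_nat (m + 1) * bernoulli_poly (m + 1) (x + 1) -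
      (odd_harmonic_sum p (x - 1) + 2 / of_nat (m + 1) * bernoulli_poly (m + 1) (x - 1 + 1)) \<in> Id j"
    if "x \<in> Z"
    using that by metis
  have "bernoulli_poly (m + 1) (- 1 - x + 1) = - bernoulli_poly (m + 1) (x + 1)"
    using bernoulli_poly_reflect[of "m + 1" "x + 1"] even_m by simp
  then show "odd_harmonic_sum p (- 1 - x) +
      2 / of_nat (m + 1) * bernoulli_poly (m + 1) (- 1 - x + 1) =
      - (odd_harmonic_sum p x + 2 / of_nat (m + 1) * bernoulli_poly (m + 1) (x + 1))"
    unfolding odd_harmonic_sum_reflect by simp
qed

subsection \<open>Multiplication formulas\<close>

text \<open>In the sum of the values at \<open>x\<close> and \<open>x - 1\<close> the inner
  arguments cancel, leaving the difference equation at \<open>x / 3\<close>; the factor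
  \<open>3 ^ m\<close> adjusts \<open>(x / 3) ^ m\<close> to \<open>x ^ m\<close>.\<close>

lemma harmonic_sum_triplication:
  assumes "x \<in> Z"
  shows "3 ^ m * (harmonic_sum p (x / 3) - harmonic_sum p (x / 3 - 1 / 3)
      + harmonic_sum p (x / 3 - 2 / 3)) - harmonic_sum p x \<in> Id j"
proof (rule alternating_poly_fun_Id[OF odd_p _ _ assms])
  let ?f = "\<lambda>x. 3 ^ m * (harmonic_sum p (x / 3) - harmonic_sum p (x / 3 - 1 / 3)
      + harmonic_sum p (x / 3 - 2 / 3)) - harmonic_sum p x"
  show "poly_fun ?f" by (intro poly_fun_intros poly_fun_harmonic_sum)
  fix x assume x: "x \<in> Z"
  have "3 ^ m * (harmonic_sum p (x / 3) + harmonic_sum p (x / 3 - 1) + 2 * (x / 3) ^ m) -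
      (harmonic_sum p x + harmonic_sum p (x - 1) + 2 * x ^ m) \<in> Id j"
    using x by (intro Id_diff Id_mult_left harmonic_sum_add_shift Z_inverse_3) auto
  also have "3 ^ m * (harmonic_sum p (x / 3) + harmonic_sum p (x / 3 - 1) + 2 * (x / 3) ^ m) -
      (harmonic_sum p x + harmonic_sum p (x - 1) + 2 * x ^ m) = ?f x + ?f (x - 1)"
  proof -
    have "(x - 1) / 3 = x / 3 - 1 / 3" "(x - 1) / 3 - 1 / 3 = x / 3 - 2 / 3"
      "(x - 1) / 3 - 2 / 3 = x / 3 - 1" by (simp_all add: field_simps)
    then show ?thesis by (simp only:) (simp add: algebra_simps power_divide)
  qed
  finally show "?f x + ?f (x - 1) \<in> Id j" .
qed

text \<open>The unit difference telescopes to the one at \<open>x / 2\<close>, and the reflection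
  interchanges the two halved arguments up to sign.\<close>

lemma odd_harmonic_sum_duplication:
  assumes "x \<in> Z"
  shows "2 ^ m * (odd_harmonic_sum p (x / 2) + odd_harmonic_sum p (x / 2 - 1 / 2))
      - odd_harmonic_sum p x \<in> Id j"
proof (rule periodic_odd_poly_fun_Id[OF odd_p _ _ _ assms])
  let ?f = "\<lambda>x. 2 ^ m * (odd_harmonic_sum p (x / 2) + odd_harmonic_sum p (x / 2 - 1 / 2))
      - odd_harmonic_sum p x"
  show "poly_fun ?f" by (intro poly_fun_intros poly_fun_odd_harmonic_sum)
  fix x
  have "2 ^ m * (odd_harmonic_sum p (x / 2) - odd_harmonic_sum p (x / 2 - 1) + 2 * (x / 2) ^ m) -
      (odd_harmonic_sum p x - odd_harmonic_sum p (x - 1) + 2 * x ^ m) \<in> Id j" if "x \<in> Z"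
    using that by (intro Id_diff Id_mult_left odd_harmonic_sum_shift Z_inverse_2) auto
  also have "2 ^ m * (odd_harmonic_sum p (x / 2) - odd_harmonic_sum p (x / 2 - 1) + 2 * (x / 2) ^ m) -
      (odd_harmonic_sum p x - odd_harmonic_sum p (x - 1) + 2 * x ^ m) = ?f x - ?f (x - 1)"
  proof -
    have "(x - 1) / 2 = x / 2 - 1 / 2" "(x - 1) / 2 - 1 / 2 = x / 2 - 1"
      by (simp_all add: field_simps)
    then show ?thesis by (simp only:) (simp add: algebra_simps power_divide)
  qed
  finally show "?f x - ?f (x - 1) \<in> Id j" if "x \<in> Z" using that .
  have "(- 1 - x) / 2 = - 1 - (x / 2 - 1 / 2)" "(- 1 - x) / 2 - 1 / 2 = - 1 - x / 2"
    by (simp_all add: field_simps)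
  then show "?f (- 1 - x) = - ?f x"
    by (simp only: odd_harmonic_sum_reflect) (simp add: algebra_simps)
qed

text \<open>The counterpart of the expression of an Euler polynomial as a difference of Bernoulli
  polynomials at half arguments.\<close>

lemma harmonic_sum_odd_harmonic_sum:
  assumes "x \<in> Z"
  shows "2 ^ m * (odd_harmonic_sum p (x / 2) - odd_harmonic_sum p (x / 2 - 1 / 2))
      - harmonic_sum p x \<in> Id j"
proof (rule alternating_poly_fun_Id[OF odd_p _ _ assms])
  let ?f = "\<lambda>x. 2 ^ m * (odd_harmonic_sum p (x / 2) - odd_harmonic_sum p (x / 2 - 1 / 2))
      - harmonic_sum p x"
  show "poly_fun ?f" by (intro poly_fun_intros poly_fun_harmonic_sum poly_fun_odd_harmonic_sum)
  fix x assume x: "x \<in> Z"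
  have "2 ^ m * (odd_harmonic_sum p (x / 2) - odd_harmonic_sum p (x / 2 - 1) + 2 * (x / 2) ^ m) -
      (harmonic_sum p x + harmonic_sum p (x - 1) + 2 * x ^ m) \<in> Id j"
    using x
    by (intro Id_diff Id_mult_left odd_harmonic_sum_shift harmonic_sum_add_shift Z_inverse_2) auto
  also have "2 ^ m * (odd_harmonic_sum p (x / 2) - odd_harmonic_sum p (x / 2 - 1) + 2 * (x / 2) ^ m) -
      (harmonic_sum p x + harmonic_sum p (x - 1) + 2 * x ^ m) = ?f x + ?f (x - 1)"
  proof -
    have "(x - 1) / 2 = x / 2 - 1 / 2" "(x - 1) / 2 - 1 / 2 = x / 2 - 1"
      by (simp_all add: field_simps)
    then show ?thesis by (simp only:) (simp add: algebra_simps power_divide)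
  qed
  finally show "?f x + ?f (x - 1) \<in> Id j" .
qed

subsection \<open>Special values\<close>

lemma Z_special: "1 / 2 \<in> Z" "1 / 3 \<in> Z" "1 / 4 \<in> Z" "1 / 6 \<in> Z"
proof -
  show 1: "1 / 2 \<in> Z" "1 / 3 \<in> Z" by (auto intro: Z_inverse_2 Z_inverse_3)
  show "1 / 4 \<in> Z" "1 / 6 \<in> Z"
    using Z_mult[OF 1(1,1)] Z_mult[OF 1] by simp_all
qed

lemma cancel_2_Id: "2 * x \<in> Id j \<Longrightarrow> x \<in> Id j" and cancel_4_Id: "4 * x \<in> Id j \<Longrightarrow> x \<in> Id j"
  using unit_cancel_Id[OF not_dvd_2, of x j] unit_cancel_Id[OF not_dvd_4, of x j] by simp_all

text \<open>Reflection moves \<open>- 1 / 4\<close> to \<open>- 3 / 4\<close>, where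
  \<open>x + 1\<close> is \<open>1 / 4\<close>.\<close>

lemma harmonic_sum_quarter: "harmonic_sum p (-1/4) + euler_poly m (1/4) \<in> Id j"
proof -
  have "harmonic_sum p (-3/4) = harmonic_sum p (-1/4)"
    using harmonic_sum_reflect[of p "-1/4"] by simp
  moreover have "harmonic_sum p (-3/4) + euler_poly m (1/4) \<in> Id j"
    using harmonic_sum_euler_poly[OF Z_mult[OF Z_of_int[of "-3"] Z_special(3)]] by simp
  ultimately show ?thesis by simp
qed

text \<open>Triplication at \<open>- 1 / 2\<close> involves \<open>- 1 / 6\<close>,
  \<open>- 1 / 2\<close> and \<open>- 5 / 6\<close>, the outer two with equal values. With
  \<open>9 * 3 ^ m\<close> congruent to 1 it reads \<open>2 * a - b = 9 * b\<close>.\<close>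

lemma harmonic_sum_sixth: "harmonic_sum p (-1/6) - 5 * harmonic_sum p (-1/2) \<in> Id j"
proof (rule cancel_2_Id)
  let ?a = "harmonic_sum p (-1/6)" and ?b = "harmonic_sum p (-1/2)"
  define t :: rat where "t = 3 ^ m"
  have t: "9 * t - 1 \<in> Id j" unfolding t_def by (rule nine_mult_power_m)
  have ab: "?a \<in> Z" "?b \<in> Z"
    using Z_harmonic_sum[OF Z_uminus[OF Z_special(4)]] Z_harmonic_sum[OF Z_uminus[OF Z_special(1)]]
    by simp_all
  have "harmonic_sum p (-5/6) = ?a"
    using harmonic_sum_reflect[of p "-1/6"] by simp
  then have "t * (2 * ?a - ?b) - ?b \<in> Id j"
    using harmonic_sum_triplication[OF Z_uminus[OF Z_special(1)], folded t_def] by simp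
  then have "9 * (t * (2 * ?a - ?b) - ?b) - (9 * t - 1) * (2 * ?a - ?b) \<in> Id j"
    using ab by (intro Id_diff[OF Id_mult_left Id_mult_right[OF t]]) auto
  then show "2 * (?a - 5 * ?b) \<in> Id j" by (simp add: algebra_simps)
qed

text \<open>The mixed formula at \<open>- 1 / 2\<close> involves \<open>- 1 / 4\<close> and
  \<open>- 3 / 4\<close>, where the odd sums are opposite.\<close>

lemma harmonic_sum_half_odd: "harmonic_sum p (-1/2) - odd_harmonic_sum p (-1/4) / 2 \<in> Id j"
proof (rule cancel_4_Id)
  let ?s = "harmonic_sum p (-1/2)" and ?c = "odd_harmonic_sum p (-1/4)"
  define t :: rat where "t = 2 ^ m"
  have t: "4 * t - 1 \<in> Id j" unfolding t_def by (rule four_mult_power_m)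
  have c: "?c \<in> Z"
    using Z_odd_harmonic_sum[OF Z_uminus[OF Z_special(3)]] by simp
  have "odd_harmonic_sum p (-3/4) = - ?c"
    using odd_harmonic_sum_reflect[of p "-1/4"] by simp
  then have "t * (2 * ?c) - ?s \<in> Id j"
    using harmonic_sum_odd_harmonic_sum[OF Z_uminus[OF Z_special(1)], folded t_def] by simp
  then have "(4 * t - 1) * (2 * ?c) - 4 * (t * (2 * ?c) - ?s) \<in> Id j"
    using c by (intro Id_diff[OF Id_mult_right[OF t] Id_mult_left]) auto
  then show "4 * (?s - ?c / 2) \<in> Id j" by (simp add: algebra_simps)
qed

text \<open>Duplication at \<open>- 1 / 3\<close>, with the value at \<open>- 2 / 3\<close>
  reflected, gives \<open>a - b = 4 * b\<close>.\<close>

lemma odd_harmonic_sum_sixth: "odd_harmonic_sum p (-1/6) - 5 * odd_harmonic_sum p (-1/3) \<in> Id j"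
proof -
  let ?a = "odd_harmonic_sum p (-1/6)" and ?b = "odd_harmonic_sum p (-1/3)"
  define t :: rat where "t = 2 ^ m"
  have t: "4 * t - 1 \<in> Id j" unfolding t_def by (rule four_mult_power_m)
  have ab: "?a \<in> Z" "?b \<in> Z"
    using Z_odd_harmonic_sum[OF Z_uminus[OF Z_special(4)]]
      Z_odd_harmonic_sum[OF Z_uminus[OF Z_special(2)]] by simp_all
  have "odd_harmonic_sum p (-2/3) = - ?b"
    using odd_harmonic_sum_reflect[of p "-1/3"] by simp
  then have "t * (?a - ?b) - ?b \<in> Id j"
    using odd_harmonic_sum_duplication[OF Z_uminus[OF Z_special(2)], folded t_def] by simp
  then have "4 * (t * (?a - ?b) - ?b) - (4 * t - 1) * (?a - ?b) \<in> Id j"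
    using ab by (intro Id_diff[OF Id_mult_left Id_mult_right[OF t]]) auto
  then show ?thesis by (simp add: algebra_simps)
qed

text \<open>The mixed formula at \<open>- 2 / 3\<close> gives \<open>4 * s = a + b\<close> after
  reflection, and \<open>a\<close> is congruent to \<open>5 * b\<close>.\<close>

lemma harmonic_sum_third_odd:
  "harmonic_sum p (-1/3) - 3 / 2 * odd_harmonic_sum p (-1/3) \<in> Id j"
proof (rule cancel_4_Id)
  let ?a = "odd_harmonic_sum p (-1/6)" and ?b = "odd_harmonic_sum p (-1/3)"
    and ?s = "harmonic_sum p (-1/3)"
  define t :: rat where "t = 2 ^ m"
  have t: "4 * t - 1 \<in> Id j" unfolding t_def by (rule four_mult_power_m)
  have ab: "?a \<in> Z" "?b \<in> Z"
    using Z_odd_harmonic_sum[OF Z_uminus[OF Z_special(4)]]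
      Z_odd_harmonic_sum[OF Z_uminus[OF Z_special(2)]] by simp_all
  have "odd_harmonic_sum p (-5/6) = - ?a" "harmonic_sum p (-2/3) = ?s"
    using odd_harmonic_sum_reflect[of p "-1/6"] harmonic_sum_reflect[of p "-1/3"] by simp_all
  then have "t * (?b + ?a) - ?s \<in> Id j"
    using harmonic_sum_odd_harmonic_sum[of "- 2 * (1 / 3)", folded t_def]
      Z_mult[OF Z_of_int[of "-2"] Z_special(2)] by simp
  then have "(4 * t - 1) * (?a + ?b) - 4 * (t * (?b + ?a) - ?s) + (?a - 5 * ?b) \<in> Id j"
    using ab
    by (intro Id_add[OF Id_diff[OF Id_mult_right[OF t] Id_mult_left]
          odd_harmonic_sum_sixth]) auto
  then show "4 * (?s - 3 / 2 * ?b) \<in> Id j" by (simp add: algebra_simps)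
qed

lemma harmonic_sum_half: "harmonic_sum p (-1/2) + 4 * euler_num m \<in> Id j"
proof -
  define t :: rat where "t = 2 ^ m"
  let ?s = "harmonic_sum p (-1/2)" and ?e = "euler_num m / t"
  have t: "4 * t - 1 \<in> Id j" unfolding t_def by (rule four_mult_power_m)
  have e: "?s + ?e \<in> Id j"
  proof -
    have "- (1 / 2) + 1 = (1 / 2 :: rat)" by simp
    then show ?thesis
      using harmonic_sum_euler_poly[OF Z_uminus[OF Z_special(1)]]
      by (simp only: euler_poly_half t_def minus_divide_left)
  qed
  have "?s \<in> Z" using Z_harmonic_sum[OF Z_uminus[OF Z_special(1)]] by simp
  \<comment> \<open>Integrality of the Euler number divided by \<open>2 ^ m\<close> comes from the
    congruence itself; it is required to replace \<open>1 / 2 ^ m\<close> by 4.\<close>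
  then have "?e \<in> Z" using Z_diff[OF Id_subset_Z[OF e], of ?s] by simp
  then have "(?s + ?e) + (4 * t - 1) * ?e \<in> Id j"
    by (rule Id_add[OF e Id_mult_right[OF t]])
  also have "(a + e) + (4 * t - 1) * e = a + 4 * (t * e)" for a e
    by (simp add: algebra_simps)
  also have "t * ?e = euler_num m" by (simp add: t_def)
  finally show ?thesis .
qed

text \<open>The odd sum at \<open>- 1 / 3\<close> yields the Bernoulli polynomial at
  \<open>2 / 3\<close>, which is minus its value at \<open>1 / 3\<close> because
  \<open>m + 1\<close> is odd.\<close>

lemma harmonic_sum_third:
  "harmonic_sum p (-1/3) - 3 / of_nat (m + 1) * bernoulli_poly (m + 1) (1/3) \<in> Id j"
proof -
  let ?b = "odd_harmonic_sum p (-1/3)" and ?s = "harmonic_sum p (-1/3)"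
    and ?\<beta> = "1 / of_nat (m + 1) * bernoulli_poly (m + 1) (1/3)"
  have "bernoulli_poly (m + 1) (2/3) = - bernoulli_poly (m + 1) (1/3)"
    using bernoulli_poly_reflect[of "m + 1" "1/3"] even_m by simp
  then have "?b - 2 * ?\<beta> \<in> Id j"
    using odd_harmonic_sum_bernoulli_poly[OF Z_uminus[OF Z_special(2)]] by simp
  then have "3 * (1 / 2) * (?b - 2 * ?\<beta>) \<in> Id j"
    by (rule Id_mult_left[OF Z_mult[OF Z_numeral Z_special(1)]])
  then have "(?s - 3 / 2 * ?b) + 3 * (1 / 2) * (?b - 2 * ?\<beta>) \<in> Id j"
    by (rule Id_add[OF harmonic_sum_third_odd])
  also have "(?s - 3 / 2 * ?b) + 3 * (1 / 2) * (?b - 2 * ?\<beta>) = ?s - 3 * ?\<beta>"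
    by (simp add: right_diff_distrib)
  finally show ?thesis by simp
qed

end


section \<open>The congruences\<close>

lemma sum_choose_mult_4:
  "(\<Sum>k=0..n. of_nat ((4*k choose 2*k) * (2*k choose k)) / 64^k * harmonic2 k) = harmonic_sum (Suc n) (-1/4)"
  unfolding harmonic_sum_def lessThan_Suc_atMost atMost_atLeast0 choose_mult_4 ..

lemma sum_choose_mult_2:
  "(\<Sum>k=0..n. of_nat ((2*k choose k)^2) / 16^k * harmonic2 k) = harmonic_sum (Suc n) (-1/2)"
  unfolding harmonic_sum_def lessThan_Suc_atMost atMost_atLeast0 choose_mult_2 ..

lemma sum_choose_mult_3:
  "(\<Sum>k=0..n. of_nat ((2*k choose k) * (3*k choose k)) / 27^k * harmonic2 k) = harmonic_sum (Suc n) (-1/3)"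
  unfolding harmonic_sum_def lessThan_Suc_atMost atMost_atLeast0 choose_mult_3 ..

lemma sum_choose_mult_6:
  "(\<Sum>k=0..n. of_nat ((6*k choose 3*k) * (3*k choose k)) / 432^k * harmonic2 k) = harmonic_sum (Suc n) (-1/6)"
  unfolding harmonic_sum_def lessThan_Suc_atMost atMost_atLeast0 choose_mult_6 ..

lemma odd_harmonic_sum_altdef:
  assumes "\<And>k. of_nat (a k) / q ^ k = hyp_coeff x k"
  shows "odd_harmonic_sum (Suc n) x =
    (2 * x + 1) * (\<Sum>k=0..n. of_nat (a k) / (of_nat (2 * k + 1) * q ^ k) * harmonic2 k)"
  unfolding odd_harmonic_sum_def lessThan_Suc_atMost atMost_atLeast0 assms[symmetric]
  by (simp only: divide_divide_eq_left mult.commute)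

context padic
begin

text \<open>Both sides inherit integrality from the common comparison value \<open>a\<close>; for
  the sums with \<open>2 * k + 1\<close> in the denominator it is not visible termwise.\<close>

lemma padic_cong_common:
  assumes "a \<in> Z" "a - x \<in> Id i" "a - y \<in> Id i"
  shows "padic_cong p i x y"
proof -
  have "a - (a - x) \<in> Z" "a - (a - y) \<in> Z"
    by (rule Z_diff[OF assms(1) Id_subset_Z], rule assms)+
  moreover have "(a - y) - (a - x) \<in> Id i"
    by (rule Id_diff[OF assms(3,2)])
  ultimately show ?thesis by (simp add: padic_cong_iff)
qed

lemma padic_congI: "x \<in> Z \<Longrightarrow> x - y \<in> Id i \<Longrightarrow> padic_cong p i x y"
  by (rule padic_cong_common[of x]) auto

end

section \<open>Exact values for the prime 5\<close>

lemma sum_lessThan_5: "(\<Sum>k<5. f k) = f 0 + f 1 + f 2 + f 3 + f (4::nat)" for f :: "nat \<Rightarrow> rat"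
  by (simp add: eval_nat_numeral)

lemma harmonic2_small: "harmonic2 1 = 1" "harmonic2 2 = 5/4" "harmonic2 3 = 49/36" "harmonic2 4 = 205/144"
  by (simp_all add: harmonic2_Suc eval_nat_numeral)

lemma hyp_coeff_small:
  "hyp_coeff x 1 = - x * (x + 1)"
  "hyp_coeff x 2 = - x * (x + 1) * ((1 - x) * (2 + x) / 4)"
  "hyp_coeff x 3 = - x * (x + 1) * ((1 - x) * (2 + x) / 4) * ((2 - x) * (3 + x) / 9)"
  "hyp_coeff x 4 = - x * (x + 1) * ((1 - x) * (2 + x) / 4) * ((2 - x) * (3 + x) / 9) * ((3 - x) * (4 + x) / 16)"
  by (simp_all add: numeral_nat hyp_coeff_def algebra_simps)

text \<open>The right side displays the factor \<open>5 ^ 2\<close>; the denominator of the cofactor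
  is prime to 5.\<close>

lemma harmonic_sum_5:
  "harmonic_sum 5 (-1/6) / 5 - harmonic_sum 5 (-1/2) = 5 ^ 2 * (-827617021 / 34828517376)"
  unfolding harmonic_sum_def sum_lessThan_5 hyp_coeff_small harmonic2_small by simp

lemma odd_harmonic_sum_5:
  "odd_harmonic_sum 5 (-1/6) / 5 - odd_harmonic_sum 5 (-1/3) = 5 ^ 2 * (-831964133 / 626913312768)"
  unfolding odd_harmonic_sum_def sum_lessThan_5 hyp_coeff_small harmonic2_small by simp

context padic_harmonic
begin

text \<open>For \<open>p = 5\<close> division by \<open>5\<close> loses one power of \<open>p\<close>, hence the explicit values above.\<close>

lemma harmonic_sum_sixth_div_5:
  "harmonic_sum p (-1/2) - harmonic_sum p (-1/6) / 5 \<in> Id j" (is ?A)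
  and odd_harmonic_sum_sixth_div_5:
  "odd_harmonic_sum p (-1/3) - odd_harmonic_sum p (-1/6) / 5 \<in> Id j" (is ?B)
proof -
  have "?A \<and> ?B"
  proof (cases "p = 5")
    case True
    have "of_int (- 827617021) / of_int 34828517376 \<in> Z" "of_int (-831964133) / of_int 626913312768 \<in> Z"
      unfolding True by (rule Z_frac[unfolded True], simp)+
    then have "harmonic_sum p (-1/6) / 5 - harmonic_sum p (-1/2) \<in> Id 2"
      "odd_harmonic_sum p (-1/6) / 5 - odd_harmonic_sum p (-1/3) \<in> Id 2"
      using Id_mult_right[OF Id_of_nat_power[of 2]]
      by (simp_all only: True harmonic_sum_5 odd_harmonic_sum_5 of_int_numeral of_int_minus of_nat_numeral)
    then have "harmonic_sum p (-1/6) / 5 - harmonic_sum p (-1/2) \<in> Id j"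
      "odd_harmonic_sum p (-1/6) / 5 - odd_harmonic_sum p (-1/3) \<in> Id j"
      using j Id_mono[where i = 2 and j = j] by auto
    then show ?thesis
      using Id_uminus by fastforce
  next
    case False
    moreover have "prime (5 :: nat)" by simp
    ultimately have "\<not> p dvd 5" using prime primes_dvd_imp_eq by blast
    then have "- (1 / 5) \<in> Z" using Z_inverse_of_nat[of 5] by simp
    from Id_mult_left[OF this harmonic_sum_sixth] Id_mult_left[OF this odd_harmonic_sum_sixth]
    show ?thesis by (simp add: right_diff_distrib)
  qed
  then show ?A ?B by auto
qed

end

lemma padic_harmonic_1:
  assumes "prime p" "p > 3"
  shows "padic_harmonic p 1 (p - 3)"
  using assms by unfold_locales auto

lemma padic_harmonic_2:
  assumes "prime p" "p > 3"
  shows "padic_harmonic p 2 (p ^ 2 - p - 2)"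
  using assms by unfold_locales auto

theorem corollary1p2:
  fixes p :: nat
  assumes "prime p" and "p > 3"
  shows
    "padic_cong p 2
       (\<Sum>k=0..p-1. of_nat ((4*k choose 2*k) * (2*k choose k)) / 64^k * harmonic2 k)
       (- euler_poly (p^2 - p - 2) (1/4)) \<and>
     padic_cong p 1
       (\<Sum>k=0..p-1. of_nat ((4*k choose 2*k) * (2*k choose k)) / 64^k * harmonic2 k)
       (- euler_poly (p - 3) (1/4)) \<and>
     padic_cong p 2
       (\<Sum>k=0..p-1. of_nat ((2*k choose k)^2) / 16^k * harmonic2 k)
       (1/4 * (\<Sum>k=0..p-1. of_nat ((4*k choose 2*k) * (2*k choose k)) /
                            (of_nat (2*k + 1) * 64^k) * harmonic2 k)) \<and>
     padic_cong p 2
       (1/4 * (\<Sum>k=0..p-1. of_nat ((4*k choose 2*k) * (2*k choose k)) /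
                            (of_nat (2*k + 1) * 64^k) * harmonic2 k))
       (1/5 * (\<Sum>k=0..p-1. of_nat ((6*k choose 3*k) * (3*k choose k)) / 432^k * harmonic2 k)) \<and>
     padic_cong p 2
       (1/5 * (\<Sum>k=0..p-1. of_nat ((6*k choose 3*k) * (3*k choose k)) / 432^k * harmonic2 k))
       (- 4 * euler_num (p^2 - p - 2)) \<and>
     padic_cong p 1
       (\<Sum>k=0..p-1. of_nat ((2*k choose k)^2) / 16^k * harmonic2 k)
       (- 4 * euler_num (p - 3)) \<and>
     padic_cong p 2
       (\<Sum>k=0..p-1. of_nat ((2*k choose k) * (3*k choose k)) / 27^k * harmonic2 k)
       (1/2 * (\<Sum>k=0..p-1. of_nat ((2*k choose k) * (3*k choose k)) /
                            (of_nat (2*k + 1) * 27^k) * harmonic2 k)) \<and>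
     padic_cong p 2
       (1/2 * (\<Sum>k=0..p-1. of_nat ((2*k choose k) * (3*k choose k)) /
                            (of_nat (2*k + 1) * 27^k) * harmonic2 k))
       (1/5 * (\<Sum>k=0..p-1. of_nat ((6*k choose 3*k) * (3*k choose k)) /
                            (of_nat (2*k + 1) * 432^k) * harmonic2 k)) \<and>
     padic_cong p 2
       (1/5 * (\<Sum>k=0..p-1. of_nat ((6*k choose 3*k) * (3*k choose k)) /
                            (of_nat (2*k + 1) * 432^k) * harmonic2 k))
       ((3 * of_nat p - 3) * bernoulli_poly (p^2 - p - 1) (1/3)) \<and>
     padic_cong p 1
       (\<Sum>k=0..p-1. of_nat ((2*k choose k) * (3*k choose k)) / 27^k * harmonic2 k)
       (- 3/2 * bernoulli_poly (p - 2) (1/3))"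
proof -
  interpret padic p
    using assms(1) by unfold_locales
  interpret h1: padic_harmonic p 1 "p - 3"
    using assms by (rule padic_harmonic_1)
  interpret h2: padic_harmonic p 2 "p ^ 2 - p - 2"
    using assms by (rule padic_harmonic_2)
  have p: "p = Suc (p - 1)" using assms by simp
  define r4 where "r4 = (\<Sum>k=0..p-1. of_nat ((4*k choose 2*k) * (2*k choose k)) /
                            (of_nat (2*k + 1) * 64^k) * harmonic2 k)"
  define r3 where "r3 = (\<Sum>k=0..p-1. of_nat ((2*k choose k) * (3*k choose k)) /
                            (of_nat (2*k + 1) * 27^k) * harmonic2 k)"
  define r6 where "r6 = (\<Sum>k=0..p-1. of_nat ((6*k choose 3*k) * (3*k choose k)) /
                            (of_nat (2*k + 1) * 432^k) * harmonic2 k)"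
  \<comment> \<open>The prefactor \<open>2 * x + 1\<close> is \<open>1 / 2\<close>,
    \<open>1 / 3\<close> and \<open>2 / 3\<close> at \<open>- 1 / 4\<close>, \<open>- 1 / 3\<close>
    and \<open>- 1 / 6\<close>.\<close>
  have r4: "odd_harmonic_sum p (-1/4) / 2 = 1/4 * r4"
    using odd_harmonic_sum_altdef[OF choose_mult_4, of "p - 1"] p unfolding r4_def by simp
  have r3: "3 / 2 * odd_harmonic_sum p (-1/3) = 1/2 * r3"
    using odd_harmonic_sum_altdef[OF choose_mult_3, of "p - 1"] p unfolding r3_def by simp
  have r6: "3 / 2 * (odd_harmonic_sum p (-1/6) / 5) = 1/5 * r6"
    using odd_harmonic_sum_altdef[OF choose_mult_6, of "p - 1"] p unfolding r6_def by simp
  have Z: "harmonic_sum p (-1/2) \<in> Z" "harmonic_sum p (-1/3) \<in> Z" "harmonic_sum p (-1/4) \<in> Z"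
    using h2.Z_special(1-3)[THEN Z_uminus, THEN Z_harmonic_sum] by simp_all

  let ?S2 = "harmonic_sum p (-1/2)" and ?S3 = "harmonic_sum p (-1/3)"
  have b1: "?S2 - 1/4 * r4 \<in> padic_ideal p 2"
    using h2.harmonic_sum_half_odd unfolding r4 .
  have b2: "?S2 - 1/5 * harmonic_sum p (-1/6) \<in> padic_ideal p 2"
    using h2.harmonic_sum_sixth_div_5 by simp
  have b3: "?S2 - - 4 * euler_num (p ^ 2 - p - 2) \<in> padic_ideal p 2"
    using h2.harmonic_sum_half by simp

  have c1: "?S3 - 1/2 * r3 \<in> padic_ideal p 2"
    using h2.harmonic_sum_third_odd unfolding r3 .
  have "3 * (1 / 2) * (odd_harmonic_sum p (-1/3) - odd_harmonic_sum p (-1/6) / 5) \<in> padic_ideal p 2"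
    by (rule Id_mult_left[OF Z_mult[OF Z_numeral h2.Z_special(1)]
          h2.odd_harmonic_sum_sixth_div_5])
  also have "3 * (1 / 2) * (odd_harmonic_sum p (-1/3) - odd_harmonic_sum p (-1/6) / 5) =
      1/2 * r3 - 1/5 * r6"
    unfolding r3[symmetric] r6[symmetric] by (simp only: right_diff_distrib mult_1_right times_divide_eq_right)
  finally have "(?S3 - 1/2 * r3) + (1/2 * r3 - 1/5 * r6) \<in> padic_ideal p 2"
    by (rule Id_add[OF c1])
  then have c2: "?S3 - 1/5 * r6 \<in> padic_ideal p 2" by simp

  define \<gamma> where "\<gamma> = 3 / of_nat (p ^ 2 - p - 2 + 1) * bernoulli_poly (p ^ 2 - p - 2 + 1) (1/3)"
  have \<gamma>: "?S3 - \<gamma> \<in> padic_ideal p 2"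
    unfolding \<gamma>_def by (rule h2.harmonic_sum_third)
  have \<gamma>_Z: "\<gamma> \<in> padic_integral p"
    using Z_diff[OF Z(2) Id_subset_Z[OF \<gamma>]] by simp
  \<comment> \<open>Ensures that the subtractions of natural numbers in the exponent do not
    truncate.\<close>
  have "4 * p \<le> p ^ 2"
    unfolding power2_eq_square using assms by (intro mult_right_mono) auto
  then have m: "p ^ 2 - p - 2 + 1 = p ^ 2 - p - 1" "p ^ 2 \<ge> p + 1"
    using assms by linarith+
  then have M: "(of_nat (p ^ 2 - p - 2 + 1) :: rat) = of_nat p ^ 2 - of_nat p - 1"
    by (simp add: of_nat_diff)
  have "(of_nat (p ^ 2 - p - 2 + 1) :: rat) \<noteq> 0"
    by (simp only: of_nat_eq_0_iff)
  then have "of_nat (p ^ 2 - p - 2 + 1) * \<gamma> = 3 * bernoulli_poly (p ^ 2 - p - 2 + 1) (1/3)"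
    unfolding \<gamma>_def by (metis mult.assoc nonzero_mult_div_cancel_left times_divide_eq_right)
  then have "of_nat (p ^ 2 - p - 2 + 1) * \<gamma> = 3 * bernoulli_poly (p ^ 2 - p - 1) (1/3)"
    by (simp only: m(1))
  then have \<beta>: "(3 * of_nat p - 3) * bernoulli_poly (p ^ 2 - p - 1) (1/3) =
      (of_nat p - 1) * ((of_nat p ^ 2 - of_nat p - 1) * \<gamma>)"
    unfolding M by simp
  \<comment> \<open>From \<open>(p - 1) * (p ^ 2 - p - 1) = 1 + p ^ 2 * (p - 2)\<close>, the factor
    \<open>p - 1\<close> inverts \<open>m + 1 = p ^ 2 - p - 1\<close> modulo
    \<open>p ^ 2\<close>.\<close>
  have "(?S3 - \<gamma>) - of_nat p ^ 2 * ((of_nat p - 2) * \<gamma>) \<in> padic_ideal p 2"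
    using \<gamma>_Z by (intro Id_diff[OF \<gamma> Id_mult_right[OF Id_of_nat_power]]) simp
  also have "(?S3 - \<gamma>) - of_nat p ^ 2 * ((of_nat p - 2) * \<gamma>) =
      ?S3 - (3 * of_nat p - 3) * bernoulli_poly (p ^ 2 - p - 1) (1/3)"
    unfolding \<beta> by (simp add: algebra_simps power2_eq_square)
  finally have c3: "?S3 - (3 * of_nat p - 3) * bernoulli_poly (p ^ 2 - p - 1) (1/3) \<in> padic_ideal p 2" .

  define \<delta> where "\<delta> = 3 / of_nat (p - 3 + 1) * bernoulli_poly (p - 3 + 1) (1/3)"
  have \<delta>: "?S3 - \<delta> \<in> padic_ideal p 1"
    unfolding \<delta>_def by (rule h1.harmonic_sum_third)
  have \<delta>_Z: "\<delta> \<in> padic_integral p"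
    using Z_diff[OF Z(2) Id_subset_Z[OF \<delta>]] by simp
  have m1: "p - 3 + 1 = p - 2" "(of_nat (p - 2) :: rat) = of_nat p - 2"
    using assms by (auto simp: of_nat_diff)
  have "of_nat (p - 2) * \<delta> = 3 * bernoulli_poly (p - 2) (1/3)"
    using assms unfolding \<delta>_def m1(1) by simp
  then have \<beta>1: "- 3/2 * bernoulli_poly (p - 2) (1/3) = - 1/2 * ((of_nat p - 2) * \<delta>)"
    unfolding m1(2) by simp
  \<comment> \<open>Here \<open>m + 1 = p - 2\<close>, and \<open>- 1 / 2\<close> is its inverse
    modulo \<open>p\<close>, with error \<open>p / 2\<close>.\<close>
  have "(?S3 - \<delta>) + of_nat p ^ 1 * (1 / 2 * \<delta>) \<in> padic_ideal p 1"
    using \<delta>_Z h2.Z_special(1)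
    by (intro Id_add[OF \<delta> Id_mult_right[OF Id_of_nat_power]] Z_mult)
  also have "(?S3 - \<delta>) + of_nat p ^ 1 * (1 / 2 * \<delta>) = ?S3 - (- 3/2 * bernoulli_poly (p - 2) (1/3))"
    unfolding \<beta>1 by (simp add: algebra_simps)
  finally have c4: "?S3 - (- 3/2 * bernoulli_poly (p - 2) (1/3)) \<in> padic_ideal p 1" .

  have a1: "harmonic_sum p (-1/4) - - euler_poly (p ^ 2 - p - 2) (1/4) \<in> padic_ideal p 2"
    using h2.harmonic_sum_quarter by simp
  have a2: "harmonic_sum p (-1/4) - - euler_poly (p - 3) (1/4) \<in> padic_ideal p 1"
    using h1.harmonic_sum_quarter by simp
  have b4: "?S2 - - 4 * euler_num (p - 3) \<in> padic_ideal p 1"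
    using h1.harmonic_sum_half by simp

  show ?thesis
    unfolding sum_choose_mult_4 sum_choose_mult_2 sum_choose_mult_3 sum_choose_mult_6 p[symmetric]
      r4_def[symmetric] r3_def[symmetric] r6_def[symmetric]
    by (intro conjI padic_congI[OF Z(3) a1] padic_congI[OF Z(3) a2]
        padic_congI[OF Z(1) b1] padic_cong_common[OF Z(1) b1 b2]
        padic_cong_common[OF Z(1) b2 b3] padic_congI[OF Z(1) b4]
        padic_congI[OF Z(2) c1] padic_cong_common[OF Z(2) c1 c2]
        padic_cong_common[OF Z(2) c2 c3] padic_congI[OF Z(2) c4])
qed

end
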